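(* Let $\mathcal{N}$ be a non-degenerate nilpotent Lie group of step two and let $m\ge 0$ be an integer. Then for all $\mathbf{y}\in\mathbb{R}^{2n}\setminus\{\mathbf{0}\}$ and $\mathbf{t}\in\mathbb{R}^r$, $$P_m(\mathbf{y},\mathbf{t})=\sum_{j=0}^{r}C_{m,j}\,\mathcal{I}_{m,j}(\mathbf{y},\mathbf{t}),$$ where $$\mathcal{I}_{m,j}(\mathbf{y},\mathbf{t})=\int_{S^{r-1}}\frac{(\det\mathcal{B}^\tau)^{1/2}\left(\langle\mathcal{B}^\tau\mathbf{y},\mathbf{y}\rangle+i\,\mathbf{t}\cdot\tau\right)^{m-j}}{\left(\langle\mathcal{B}^\tau\mathbf{y},\mathbf{y}\rangle-i\,\mathbf{t}\cdot\tau\right)^{m+n+r-j}}\,d\tau,\qquad C_{m,j}=\frac{(-1)^m2^{n-r}}{\pi^{n+r}}\binom{r}{j}\frac{(m+n+r-1-j)!}{(m-j)!},$$ with the convention $C_{m,j}=0$ for $j>m$.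
   Context: Let $n,r\ge1$ and let $B=(B^1,\dots,B^r):\mathbb{R}^{2n}\times\mathbb{R}^{2n}\to\mathbb{R}^r$ be a skew-symmetric bilinear map, $B^\beta(\mathbf{x},\mathbf{y})=\sum_{k,l}B^\beta_{kl}x_ky_l$. The nilpotent Lie group of step two $\mathcal{N}$ is $\mathbb{R}^{2n}\times\mathbb{R}^r$ with product $(\mathbf{x},\mathbf{t})\cdot(\mathbf{y},\mathbf{s})=(\mathbf{x}+\mathbf{y},\mathbf{t}+\mathbf{s}+2B(\mathbf{x},\mathbf{y}))$. For $\tau\in\mathbb{R}^r$ let $B^\tau=\sum_\beta\tau_\beta B^\beta$ (a skew-symmetric $2n\times2n$ matrix, $B^\beta=(B^\beta_{kl})$). $\mathcal{N}$ is non-degenerate if $B^\tau$ is invertible for every $\tau\ne0$. $\mathcal{B}^\tau:=[(B^\tau)^tB^\tau]^{1/2}$ is the positive semidefinite square root. $d\tau$ on $S^{r-1}$ is the surface measure (counting measure if $r=1$). For $\tau\ne0$ let $\pm i\mu_1(\tau),\dots,\pm i\mu_n(\tau)$, $\mu_1(\tau)\ge\dots\ge\mu_n(\tau)>0$, be the eigenvalues of $B^\tau$, and choose an orthonormal basis $v_1^\tau,\dots,v_{2n}^\tau$ of $\mathbb{R}^{2n}$ (depending only on $\tau/|\tau|$) such that $O(\tau)=(v_1^\tau,\dots,v_{2n}^\tau)$ satisfies $O(\tau)^tB^\tau O(\tau)=$ block diagonal matrix with blocks $\begin{pmatrix}0&-\mu_j(\tau)\\ \mu_j(\tau)&0\end{pmatrix}$.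 Write $\mathbf{y}=\sum_k y_k^\tau v_k^\tau$ and $\mathbf{y}_j^\tau=(y_{2j-1}^\tau,y_{2j}^\tau)$. With $L_k^{(p)}$ the generalized Laguerre polynomials, for $\mathbf{k}\in\mathbb{Z}_{\ge0}^n$ put $$\widetilde{\mathscr L}_{\mathbf{k}}^{(\mathbf{0})}(\mathbf{y},\tau)=\prod_{j=1}^n\frac{2\mu_j(\tau)}{\pi}L_{k_j}^{(0)}\big(2\mu_j(\tau)|\mathbf{y}_j^\tau|^2\big)e^{-\mu_j(\tau)|\mathbf{y}_j^\tau|^2},\qquad Q_m(\mathbf{y},\tau)=\sum_{|\mathbf{k}|=m}\widetilde{\mathscr L}_{\mathbf{k}}^{(\mathbf{0})}(\mathbf{y},\tau).$$ For $\mathbf{y}\ne\mathbf{0}$, $Q_m(\mathbf{y},\cdot)$ is integrable on $\mathbb{R}^r$ and $$P_m(\mathbf{y},\mathbf{t}):=\frac1{(2\pi)^r}\int_{\mathbb{R}^r}e^{i\mathbf{t}\cdot\tau}Q_m(\mathbf{y},\tau)\,d\tau.$$ *)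

theory Defs
  imports "HOL-Analysis.Analysis"
begin

text \<open>
  Two-step groups are represented by their bilinear map: the group
  attached to \<open>B\<close> is \<open>(real^'m) \<times> (real^'r)\<close> with product
  \<open>(x, t) \<cdot> (y, s) = (x + y, t + s + 2 B x y)\<close>. Here \<open>CARD('m) = 2 * n\<close>, and the indices
  \<open>1, \<dots>, n\<close> and \<open>1, \<dots>, 2 * n\<close> of eigenvalues and of frame vectors are natural numbers.
\<close>

definition skew_bilinear :: "(real^'m \<Rightarrow> real^'m \<Rightarrow> real^'r) \<Rightarrow> bool" where
  "skew_bilinear B \<longleftrightarrow> bilinear B \<and> (\<forall>x y. B x y = - B y x)"

definition Bcomp :: "(real^'m \<Rightarrow> real^'m \<Rightarrow> real^'r) \<Rightarrow> 'r \<Rightarrow> real^'m^'m" where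
  "Bcomp B \<beta> = (\<chi> k l. B (axis k 1) (axis l 1) $ \<beta>)"

definition Bmat :: "(real^'m \<Rightarrow> real^'m \<Rightarrow> real^'r) \<Rightarrow> real^'r \<Rightarrow> real^'m^'m" where
  "Bmat B \<tau> = (\<Sum>\<beta>\<in>UNIV. (\<tau> $ \<beta>) *\<^sub>R Bcomp B \<beta>)"

definition nondegenerate :: "(real^'m \<Rightarrow> real^'m \<Rightarrow> real^'r) \<Rightarrow> bool" where
  "nondegenerate B \<longleftrightarrow> (\<forall>\<tau>. \<tau> \<noteq> 0 \<longrightarrow> invertible (Bmat B \<tau>))"

definition psd :: "real^'m^'m \<Rightarrow> bool" where
  "psd S \<longleftrightarrow> transpose S = S \<and> (\<forall>x. 0 \<le> (S *v x) \<bullet> x)"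

definition psd_sqrt :: "real^'m^'m \<Rightarrow> real^'m^'m" where
  "psd_sqrt A = (THE S. psd S \<and> S ** S = A)"

definition Babs :: "(real^'m \<Rightarrow> real^'m \<Rightarrow> real^'r) \<Rightarrow> real^'r \<Rightarrow> real^'m^'m" where
  "Babs B \<tau> = psd_sqrt (transpose (Bmat B \<tau>) ** Bmat B \<tau>)"

text \<open>
  The \<open>(k, l)\<close> entry (\<open>k, l \<ge> 1\<close>) of the block diagonal matrix whose \<open>j\<close>-th block is
  \<open>(0, -\<mu> j; \<mu> j, 0)\<close>, in rows and columns \<open>2 * j - 1\<close> and \<open>2 * j\<close>.
\<close>

definition skew_block :: "(nat \<Rightarrow> real) \<Rightarrow> nat \<Rightarrow> nat \<Rightarrow> real" where
  "skew_block \<mu> k l =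
     (if odd k \<and> l = k + 1 then - \<mu> (l div 2)
      else if odd l \<and> k = l + 1 then \<mu> (k div 2)
      else 0)"

text \<open>
  The first condition below says that \<open>\<plusminus>\<i> \<mu> 1, \<dots>, \<plusminus>\<i> \<mu> n\<close> are the complex eigenvalues of \<open>A\<close>
  with multiplicity; the last one is \<open>O\<^sup>t A O\<close> = block diagonal matrix, read entrywise
  for the matrix \<open>O\<close> with columns \<open>v 1, \<dots>, v (2 * n)\<close>.
\<close>

definition skew_normal_form ::
    "nat \<Rightarrow> real^'m^'m \<Rightarrow> (nat \<Rightarrow> real) \<Rightarrow> (nat \<Rightarrow> real^'m) \<Rightarrow> bool" where
  "skew_normal_form n A \<mu> v \<longleftrightarrow>
     (\<forall>z::complex. det (mat z - (\<chi> k l. complex_of_real (A $ k $ l))) =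
        (\<Prod>j=1..n. (z - \<i> * of_real (\<mu> j)) * (z + \<i> * of_real (\<mu> j)))) \<and>
     (\<forall>i\<in>{1..n}. \<forall>j\<in>{1..n}. i \<le> j \<longrightarrow> \<mu> j \<le> \<mu> i) \<and>
     (\<forall>j\<in>{1..n}. 0 < \<mu> j) \<and>
     (\<forall>k\<in>{1..2*n}. \<forall>l\<in>{1..2*n}. v k \<bullet> v l = (if k = l then 1 else 0)) \<and>
     (\<forall>k\<in>{1..2*n}. \<forall>l\<in>{1..2*n}. v k \<bullet> (A *v v l) = skew_block \<mu> k l)"

definition admissible_frame ::
    "nat \<Rightarrow> (real^'m \<Rightarrow> real^'m \<Rightarrow> real^'r) \<Rightarrow> (real^'r \<Rightarrow> nat \<Rightarrow> real) \<Rightarrow>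
     (real^'r \<Rightarrow> nat \<Rightarrow> real^'m) \<Rightarrow> bool" where
  "admissible_frame n B \<mu> v \<longleftrightarrow>
     (\<forall>\<tau>. \<tau> \<noteq> 0 \<longrightarrow> skew_normal_form n (Bmat B \<tau>) (\<mu> \<tau>) (v \<tau>)) \<and>
     (\<forall>\<tau>. \<tau> \<noteq> 0 \<longrightarrow> (\<forall>k\<in>{1..2*n}. v \<tau> k = v (\<tau> /\<^sub>R norm \<tau>) k))"

definition laguerre :: "real \<Rightarrow> nat \<Rightarrow> real \<Rightarrow> real" where
  "laguerre p k x = (\<Sum>i\<le>k. (-1) ^ i * ((real k + p) gchoose (k - i)) * x ^ i / fact i)"

text \<open>\<open>|y_j|\<^sup>2\<close> for the \<open>j\<close>-th pair of coordinates of \<open>y\<close> in the orthonormal frame \<open>v\<close>.\<close>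

definition pair_normsq :: "(nat \<Rightarrow> real^'m) \<Rightarrow> real^'m \<Rightarrow> nat \<Rightarrow> real" where
  "pair_normsq v y j = (y \<bullet> v (2 * j - 1))\<^sup>2 + (y \<bullet> v (2 * j))\<^sup>2"

definition scriptL ::
    "nat \<Rightarrow> (real^'r \<Rightarrow> nat \<Rightarrow> real) \<Rightarrow> (real^'r \<Rightarrow> nat \<Rightarrow> real^'m) \<Rightarrow>
     (nat \<Rightarrow> nat) \<Rightarrow> real^'m \<Rightarrow> real^'r \<Rightarrow> real" where
  "scriptL n \<mu> v k y \<tau> =
     (\<Prod>j=1..n. 2 * \<mu> \<tau> j / pi
        * laguerre 0 (k j) (2 * \<mu> \<tau> j * pair_normsq (v \<tau>) y j)
        * exp (- \<mu> \<tau> j * pair_normsq (v \<tau>) y j))"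

definition Q ::
    "nat \<Rightarrow> (real^'r \<Rightarrow> nat \<Rightarrow> real) \<Rightarrow> (real^'r \<Rightarrow> nat \<Rightarrow> real^'m) \<Rightarrow>
     nat \<Rightarrow> real^'m \<Rightarrow> real^'r \<Rightarrow> real" where
  "Q n \<mu> v m y \<tau> =
     (\<Sum>k | k \<in> {1..n} \<rightarrow>\<^sub>E (UNIV :: nat set) \<and> (\<Sum>j=1..n. k j) = m. scriptL n \<mu> v k y \<tau>)"

definition P ::
    "nat \<Rightarrow> (real^'r \<Rightarrow> nat \<Rightarrow> real) \<Rightarrow> (real^'r \<Rightarrow> nat \<Rightarrow> real^'m) \<Rightarrow>
     nat \<Rightarrow> real^'m \<Rightarrow> real^'r \<Rightarrow> complex" where
  "P n \<mu> v m y t =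
     1 / (2 * of_real pi) ^ CARD('r) *
     (LINT \<tau>|lborel. exp (\<i> * of_real (t \<bullet> \<tau>)) * of_real (Q n \<mu> v m y \<tau>))"

text \<open>
  Surface measure on the unit sphere, normalised as in polar coordinates: the measure of
  \<open>A\<close> is the dimension times the Lebesgue measure of the cone over \<open>A\<close> in the unit ball (see
  the lemma below). In dimension 1 each of the two points has mass 1.
\<close>

definition sphere_measure :: "'a::euclidean_space measure" where
  "sphere_measure =
     scale_measure (of_nat DIM('a))
       (distr (restrict_space lborel (cball 0 1 - {0}))
         (restrict_space borel (sphere 0 1)) (\<lambda>x. x /\<^sub>R norm x))"

lemma space_sphere_measure: "space (sphere_measure :: 'a::euclidean_space measure) = sphere 0 1"
  by (simp add: sphere_measure_def space_scale_measure space_restrict_space)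

lemma emeasure_sphere_measure:
  fixes A :: "'a::euclidean_space set"
  assumes A: "A \<in> sets borel" "A \<subseteq> sphere 0 1"
  shows "emeasure sphere_measure A =
    of_nat DIM('a) * emeasure lborel {s *\<^sub>R x | s x. 0 < s \<and> s \<le> 1 \<and> x \<in> A}"
proof -
  let ?p = "\<lambda>x::'a. x /\<^sub>R norm x"
  let ?M = "restrict_space (lborel :: 'a measure) (cball 0 1 - {0})"
  have meas: "?p \<in> measurable ?M (restrict_space borel (sphere 0 1))"
    by (rule measurable_restrict_space2)
       (auto simp: space_restrict_space intro!: measurable_restrict_space1)
  have cone: "?p -` A \<inter> space ?M = {s *\<^sub>R x | s x. 0 < s \<and> s \<le> 1 \<and> x \<in> A}"
  proof (intro equalityI subsetI)
    fix x assume "x \<in> ?p -` A \<inter> space ?M"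
    then have "?p x \<in> A" "0 < norm x" "norm x \<le> 1" "x = norm x *\<^sub>R ?p x"
      by (auto simp: space_restrict_space)
    then show "x \<in> {s *\<^sub>R x | s x. 0 < s \<and> s \<le> 1 \<and> x \<in> A}" by blast
  next
    fix x assume "x \<in> {s *\<^sub>R x | s x. 0 < s \<and> s \<le> 1 \<and> x \<in> A}"
    then obtain s z where "x = s *\<^sub>R z" "0 < s" "s \<le> 1" "z \<in> A" by blast
    moreover from this A have "norm z = 1" by auto
    ultimately show "x \<in> ?p -` A \<inter> space ?M" by (auto simp: space_restrict_space)
  qed
  have sub: "?p -` A \<inter> space ?M \<subseteq> cball 0 1 - {0}"
    by (auto simp: space_restrict_space)
  have "A \<in> sets (restrict_space borel (sphere 0 1))"
    using A by (auto simp: sets_restrict_space)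
  then show ?thesis
    using meas sub
    by (simp add: sphere_measure_def emeasure_distr emeasure_restrict_space flip: cone)
qed

definition I_int ::
    "nat \<Rightarrow> (real^'m \<Rightarrow> real^'m \<Rightarrow> real^'r) \<Rightarrow> nat \<Rightarrow> nat \<Rightarrow> real^'m \<Rightarrow> real^'r \<Rightarrow> complex" where
  "I_int n B m j y t =
     (LINT \<tau>|sphere_measure.
        of_real (sqrt (det (Babs B \<tau>)))
        * (of_real ((Babs B \<tau> *v y) \<bullet> y) + \<i> * of_real (t \<bullet> \<tau>)) powi (int m - int j)
        / (of_real ((Babs B \<tau> *v y) \<bullet> y) - \<i> * of_real (t \<bullet> \<tau>))
            powi (int m + int n + int CARD('r) - int j))"

definition C_const :: "nat \<Rightarrow> nat \<Rightarrow> nat \<Rightarrow> nat \<Rightarrow> real" where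
  "C_const n r m j =
     (if j \<le> m then
        (-1) ^ m * 2 powi (int n - int r) / pi ^ (n + r)
        * real (r choose j) * (fact (m + n + r - 1 - j) / fact (m - j))
      else 0)"

end

theory Submission
  imports Defs
begin

text \<open>
  The product of the generating functions of the Laguerre polynomials gives the addition formula
  \<open>\<Sum>\<^sub>|\<^sub>k\<^sub>|\<^sub>=\<^sub>m \<Prod>\<^sub>j L\<^sub>k\<^sub>j\<^sup>(\<^sup>0\<^sup>) (x\<^sub>j) = L\<^sub>m\<^sup>(\<^sup>n\<^sup>-\<^sup>1\<^sup>) (\<Sum>\<^sub>j x\<^sub>j)\<close>. Together with \<open>\<langle>|B\<^sup>\<tau>| y, y\<rangle> = \<Sum>\<^sub>j \<mu>\<^sub>j |y\<^sub>j|\<^sup>2\<close> and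
  \<open>det |B\<^sup>\<tau>| = \<Prod>\<^sub>j \<mu>\<^sub>j\<^sup>2\<close> it shows that \<open>Q\<^sub>m\<close> depends on \<open>|B\<^sup>\<tau>|\<close> only, which is homogeneous in \<open>\<tau>\<close>, and
  continuous by uniqueness of the positive square root. In polar coordinates the radial integral is
  a combination of Laplace transforms of powers at \<open>z = \<langle>|B\<^sup>\<tau>| y, y\<rangle> - i t \<cdot> \<tau>\<close>; since
  \<open>2 \<langle>|B\<^sup>\<tau>| y, y\<rangle> = z + w\<close> with \<open>w\<close> the conjugate of \<open>z\<close>, expanding in powers of \<open>w / z\<close> and summing the
  coefficients by Vandermonde's identity gives the claim.
\<close>

section \<open>Laguerre polynomials\<close>

text \<open>Upper negation gives both diagonal binomials a fixed upper entry, so that Vandermonde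
  applies; a second negation returns to the diagonal form. The shift by 1 reflects that the
  exponents -a-1 and -b-1 of 1-u add up to -(a+b+1)-1.\<close>

lemma gbinomial_convolution:
  fixes a b :: "'a::field_char_0"
  shows "(\<Sum>q\<le>n. ((of_nat q + a) gchoose q) * ((of_nat (n - q) + b) gchoose (n - q)))
    = (of_nat n + (a + b + 1)) gchoose n"
proof -
  have neg: "(of_nat q + c) gchoose q = (-1) ^ q * ((- (c + 1)) gchoose q)" for q and c :: 'a
    unfolding gbinomial_negated_upper[of "of_nat q + c"] by simp
  have "(\<Sum>q\<le>n. ((of_nat q + a) gchoose q) * ((of_nat (n - q) + b) gchoose (n - q)))
      = (\<Sum>q\<le>n. (-1) ^ n * (((- (a + 1)) gchoose q) * ((- (b + 1)) gchoose (n - q))))"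
    unfolding neg by (intro sum.cong refl) (simp add: power_add[symmetric] mult_ac)
  also have "\<dots> = (-1) ^ n * ((- (a + 1) + - (b + 1)) gchoose n)"
    unfolding gbinomial_Vandermonde[symmetric] by (simp add: sum_distrib_left atMost_atLeast0)
  also have "- (a + 1) + - (b + 1) = - (a + b + 1 + 1)" by simp
  also have "(-1) ^ n * (\<dots> gchoose n) = (of_nat n + (a + b + 1)) gchoose n"
    by (rule neg[symmetric])
  finally show ?thesis .
qed

text \<open>The power series of \<open>(1 - u)\<^bsup>-p-1\<^esup>\<close>.\<close>

definition fps_gbinomial_diag :: "real \<Rightarrow> real fps" where
  "fps_gbinomial_diag p = Abs_fps (\<lambda>q. (real q + p) gchoose q)"

lemma fps_gbinomial_diag_mult:
  "fps_gbinomial_diag p * fps_gbinomial_diag q = fps_gbinomial_diag (p + q + 1)"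
  unfolding fps_gbinomial_diag_def
  by (rule fps_ext) (simp add: fps_mult_nth gbinomial_convolution del: of_nat_diff flip: atMost_atLeast0)

text \<open>Here \<open>fps_X * fps_gbinomial_diag 0\<close> is u/(1-u), the series substituted into
  the exponential of the generating function. Each factor contributes one u and raises the index by
  0 + 1.\<close>

lemma fps_gbinomial_diag_mult_power:
  "fps_gbinomial_diag p * (fps_X * fps_gbinomial_diag 0) ^ i
    = fps_X ^ i * fps_gbinomial_diag (p + real i)"
proof (induction i arbitrary: p)
  case (Suc i)
  have "fps_gbinomial_diag p * (fps_X * fps_gbinomial_diag 0) ^ Suc i
      = fps_X * (fps_gbinomial_diag p * fps_gbinomial_diag 0) * (fps_X * fps_gbinomial_diag 0) ^ i"
    by (simp add: mult_ac)
  also have "\<dots> = fps_X * (fps_gbinomial_diag (p + 1) * (fps_X * fps_gbinomial_diag 0) ^ i)"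
    by (simp add: fps_gbinomial_diag_mult mult_ac)
  also have "\<dots> = fps_X ^ Suc i * fps_gbinomial_diag (p + real (Suc i))"
    by (simp add: Suc.IH add_ac mult_ac)
  finally show ?case .
qed simp

definition laguerre_fps :: "real \<Rightarrow> real \<Rightarrow> real fps" where
  "laguerre_fps p x = Abs_fps (\<lambda>k. laguerre p k x)"

lemma laguerre_fps_nth [simp]: "fps_nth (laguerre_fps p x) k = laguerre p k x"
  by (simp add: laguerre_fps_def)

text \<open>The classical generating function \<open>(1 - u)\<^bsup>-p-1\<^esup> exp (-x u / (1 - u))\<close>.\<close>

lemma laguerre_fps_eq:
  "laguerre_fps p x
    = fps_gbinomial_diag p * (fps_exp (- x) oo (fps_X * fps_gbinomial_diag 0))"
proof (rule fps_ext)
  fix k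
  let ?c = "fps_X * fps_gbinomial_diag 0"
  \<comment> \<open>The inner series has no constant term, so its i-th power starts at degree i. All
    coefficient sums of the composition can thus run up to k, and the two summations can be
    exchanged.\<close>
  have van: "fps_nth (?c ^ i) l = 0" if "l < i" for i l
    using that by (simp add: power_mult_distrib fps_X_power_mult_nth)
  have "fps_nth (fps_gbinomial_diag p * (fps_exp (- x) oo ?c)) k
      = (\<Sum>l=0..k. \<Sum>i=0..k. fps_nth (fps_gbinomial_diag p) l * (fps_nth (fps_exp (- x)) i * fps_nth (?c ^ i) (k - l)))"
    unfolding fps_mult_nth fps_compose_nth sum_distrib_left
    by (intro sum.cong refl sum.mono_neutral_left) (auto simp: van)
  also have "\<dots> = (\<Sum>i=0..k. fps_nth (fps_exp (- x)) i * fps_nth (fps_gbinomial_diag p * ?c ^ i) k)"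
    by (subst sum.swap) (simp add: fps_mult_nth sum_distrib_left mult_ac)
  also have "\<dots> = (\<Sum>i=0..k. (- x) ^ i / fact i * ((real k + p) gchoose (k - i)))"
    unfolding fps_gbinomial_diag_mult_power
    by (intro sum.cong refl)
       (auto simp: fps_X_power_mult_nth fps_gbinomial_diag_def of_nat_diff algebra_simps)
  also have "\<dots> = laguerre p k x"
    unfolding laguerre_def
    by (intro sum.cong) (auto simp: power_minus[of x] mult_ac)
  finally show "fps_nth (laguerre_fps p x) k
      = fps_nth (fps_gbinomial_diag p * (fps_exp (- x) oo ?c)) k" by simp
qed

text \<open>In the generating function x enters through an exponential and p through an exponent of
  1-u, so both add; the extra 1 comes from multiplying two series
  \<open>fps_gbinomial_diag\<close>.\<close>

lemma laguerre_fps_mult: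
  "laguerre_fps p x * laguerre_fps q y = laguerre_fps (p + q + 1) (x + y)"
proof -
  have "fps_exp (- (x + y)) oo (fps_X * fps_gbinomial_diag 0)
      = (fps_exp (- x) oo (fps_X * fps_gbinomial_diag 0))
        * (fps_exp (- y) oo (fps_X * fps_gbinomial_diag 0))"
    using fps_exp_add_mult[of "- x" "- y"]
    by (subst fps_compose_mult_distrib[symmetric]) (simp_all add: algebra_simps)
  then show ?thesis
    unfolding laguerre_fps_eq fps_gbinomial_diag_mult[symmetric] by (simp add: mult_ac)
qed

text \<open>Each of the n - 1 multiplications adds 1 to the parameter, starting from 0.\<close>

lemma prod_laguerre_fps:
  assumes "1 \<le> n"
  shows "(\<Prod>j=1..n. laguerre_fps 0 (x j)) = laguerre_fps (real n - 1) (\<Sum>j=1..n. x j)"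
  using assms
proof (induction n rule: dec_induct)
  case (step n)
  then show ?case by (simp add: laguerre_fps_mult)
qed simp

lemma finite_PiE_sum_eq:
  fixes m :: nat
  assumes "finite A"
  shows "finite {k. k \<in> A \<rightarrow>\<^sub>E (UNIV :: nat set) \<and> (\<Sum>j\<in>A. k j) = m}"
proof (rule finite_subset)
  show "{k. k \<in> A \<rightarrow>\<^sub>E (UNIV :: nat set) \<and> (\<Sum>j\<in>A. k j) = m} \<subseteq> A \<rightarrow>\<^sub>E {..m}"
    using assms by (auto simp: PiE_iff extensional_def intro: member_le_sum)
  show "finite (A \<rightarrow>\<^sub>E {..m})" using assms by (intro finite_PiE) auto
qed

lemma fps_prod_nth_PiE:
  fixes f :: "'b \<Rightarrow> 'a::comm_ring_1 fps"
  assumes "finite A"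
  shows "fps_nth (\<Prod>j\<in>A. f j) m
    = (\<Sum>k | k \<in> A \<rightarrow>\<^sub>E (UNIV :: nat set) \<and> (\<Sum>j\<in>A. k j) = m. \<Prod>j\<in>A. fps_nth (f j) (k j))"
  using assms
proof (induction A arbitrary: m rule: finite_induct)
  case empty
  have "{k. k \<in> {} \<rightarrow>\<^sub>E (UNIV :: nat set) \<and> (\<Sum>j\<in>{}. k j) = m}
      = (if m = 0 then {\<lambda>_. undefined} else {})" by auto
  then show ?case by simp
next
  case (insert a A)
  let ?K = "\<lambda>A m. {k. k \<in> A \<rightarrow>\<^sub>E (UNIV :: nat set) \<and> (\<Sum>j\<in>A. k j) = m}"
  have upd: "(\<Sum>j\<in>A. (k(a := i)) j) = (\<Sum>j\<in>A. k j)"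
       "(\<Prod>j\<in>A. fps_nth (f j) ((k(a := i)) j)) = (\<Prod>j\<in>A. fps_nth (f j) (k j))" for k i
    using insert.hyps by (auto intro!: sum.cong prod.cong)
  have "fps_nth (\<Prod>j\<in>insert a A. f j) m = (\<Sum>i=0..m. fps_nth (f a) i * (\<Sum>k\<in>?K A (m - i). \<Prod>j\<in>A. fps_nth (f j) (k j)))"
    using insert by (simp add: fps_mult_nth)
  also have "\<dots> = (\<Sum>(i, k)\<in>(SIGMA i:{0..m}. ?K A (m - i)). fps_nth (f a) i * (\<Prod>j\<in>A. fps_nth (f j) (k j)))"
    unfolding sum_distrib_left using insert.hyps by (intro sum.Sigma) (auto intro: finite_PiE_sum_eq)
  also have "\<dots> = (\<Sum>k\<in>?K (insert a A) m. \<Prod>j\<in>insert a A. fps_nth (f j) (k j))"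
  \<comment> \<open>A function on \<open>insert a A\<close> is split into its value at a and the
    rest. Resetting the value at a to \<open>undefined\<close> makes the rest extensional on A
    again.\<close>
  proof (rule sum.reindex_bij_witness[where i = "\<lambda>k. (k a, k(a := undefined))"
        and j = "\<lambda>(i, k). k(a := i)"], goal_cases)
    case (1 p)
    then show ?case using insert.hyps by (auto simp: PiE_iff extensional_def fun_eq_iff)
  next
    case (2 p)
    then show ?case using insert.hyps upd by (auto simp: PiE_iff extensional_def)
  next
    case (3 k)
    then show ?case by auto
  next
    case (4 k)
    then show ?case using insert.hyps upd by (auto simp: PiE_iff extensional_def)
  next
    case (5 p)
    then show ?case using insert.hyps upd by (auto simp: case_prod_beta)
  qed
  finally show ?case .
qed

lemma laguerre_sum_formula:
  assumes "1 \<le> n"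
  shows "(\<Sum>k | k \<in> {1..n} \<rightarrow>\<^sub>E (UNIV :: nat set) \<and> (\<Sum>j=1..n. k j) = m.
      \<Prod>j=1..n. laguerre 0 (k j) (x j)) = laguerre (real n - 1) m (\<Sum>j=1..n. x j)"
  using fps_prod_nth_PiE[of "{1..n}" "\<lambda>j. laguerre_fps 0 (x j)" m] prod_laguerre_fps[OF assms, of x]
  by simp


section \<open>Binomial sums produced by the radial integral\<close>

text \<open>Upper negation of the first factor absorbs the alternating sign and leaves a Vandermonde
  sum with upper entry -(N+1) + (N+M-r) = M-r-1; negating once more gives r. The bound
  \<open>r \<le> N\<close> makes the natural subtraction exact.\<close>

lemma binomial_alternating_convolution:
  fixes N r M :: nat
  assumes "r \<le> N"
  shows "(\<Sum>q\<le>M. (-1) ^ q * of_nat ((N + q) choose q) * of_nat ((N + M - r) choose (M - q)))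
    = (-1) ^ M * (of_nat (r choose M) :: 'a::field_char_0)"
proof -
  have "(\<Sum>q\<le>M. (-1) ^ q * of_nat ((N + q) choose q) * of_nat ((N + M - r) choose (M - q)))
      = (\<Sum>q\<le>M. ((- (of_nat N + 1)) gchoose q) * ((of_nat (N + M - r) :: 'a) gchoose (M - q)))"
    unfolding gbinomial_minus binomial_gbinomial
    by (intro sum.cong refl) (simp add: add_ac)
  also have "\<dots> = (- (of_nat N + 1) + of_nat (N + M - r)) gchoose M"
    by (simp only: gbinomial_Vandermonde atMost_atLeast0)
  also have "\<dots> = (-1) ^ M * (of_nat r gchoose M)"
    using assms by (subst gbinomial_negated_upper) (simp add: of_nat_diff)
  finally show ?thesis by (simp add: binomial_gbinomial)
qed

text \<open>The left side is what the coefficients of the Laguerre polynomial of parameter n - 1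
  become under radial integration, with 1 + w in the role of 2b/z. Expanding (1 + w)^i leaves, for
  each power w^p, an alternating binomial sum that collapses to one term; finally p = m - j.\<close>

lemma laguerre_laplace_identity:
  fixes w :: "'a::field_char_0"
  assumes n: "1 \<le> n"
  shows "(\<Sum>i\<le>m. (-1) ^ i * of_nat ((m + n - 1) choose (m - i))
        * (fact (n + r - 1 + i) / fact i) * (1 + w) ^ i)
    = (-1) ^ m * (\<Sum>j=0..r. if j \<le> m
        then of_nat (r choose j) * (fact (m + n + r - 1 - j) / fact (m - j)) * w ^ (m - j) else 0)"
proof -
  define c where "c i = (-1) ^ i * of_nat ((m + n - 1) choose (m - i))
      * (fact (n + r - 1 + i) / fact i :: 'a)" for i
  have inner: "(\<Sum>q\<le>m - p. c (p + q) * of_nat ((p + q) choose p))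
      = (-1) ^ m * of_nat (r choose (m - p)) * (fact (n + r - 1 + p) / fact p)" if p: "p \<le> m" for p
  proof -
    \<comment> \<open>Chosen so that N + M - r is the upper entry m + n - 1 of the Laguerre
      coefficients; \<open>1 \<le> n\<close> gives r \<le> N.\<close>
    let ?N = "n + r - 1 + p" and ?M = "m - p"
    have eq: "?N + ?M - r = m + n - 1" "r \<le> ?N" using p n by auto
    have "c (p + q) * of_nat ((p + q) choose p) = (-1) ^ p * (fact ?N / fact p)
        * ((-1) ^ q * of_nat ((?N + q) choose q) * of_nat ((?N + ?M - r) choose (?M - q)))"
      if "q \<le> ?M" for q
      unfolding c_def eq
      by (simp add: binomial_fact power_add add_ac)
    then have "(\<Sum>q\<le>?M. c (p + q) * of_nat ((p + q) choose p)) = (-1) ^ p * (fact ?N / fact p)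
        * (\<Sum>q\<le>?M. (-1) ^ q * of_nat ((?N + q) choose q) * of_nat ((?N + ?M - r) choose (?M - q)))"
      by (simp add: sum_distrib_left)
    also have "\<dots> = (-1) ^ p * (fact ?N / fact p) * ((-1) ^ ?M * of_nat (r choose ?M))"
      by (subst binomial_alternating_convolution[OF eq(2)]) simp
    also have "\<dots> = (-1) ^ (p + ?M) * of_nat (r choose ?M) * (fact ?N / fact p)"
      by (simp add: power_add)
    finally show ?thesis using p by simp
  qed
  have "(\<Sum>i\<le>m. c i * (1 + w) ^ i) = (\<Sum>i\<le>m. \<Sum>p\<le>i. c i * of_nat (i choose p) * w ^ p)"
    by (subst add.commute) (simp add: binomial_ring sum_distrib_left mult_ac)
  also have "\<dots> = (\<Sum>(i, p)\<in>(SIGMA i:{..m}. {..i}). c i * of_nat (i choose p) * w ^ p)"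
    by (rule sum.Sigma) auto
  also have "\<dots> = (\<Sum>(p, q)\<in>(SIGMA p:{..m}. {..m - p}). c (p + q) * of_nat ((p + q) choose p) * w ^ p)"
    by (rule sum.reindex_bij_witness[where i = "\<lambda>(p, q). (p + q, p)" and j = "\<lambda>(i, p). (p, i - p)"]) auto
  also have "\<dots> = (\<Sum>p\<le>m. (\<Sum>q\<le>m - p. c (p + q) * of_nat ((p + q) choose p)) * w ^ p)"
    unfolding sum_distrib_right by (rule sum.Sigma[symmetric]) auto
  also have "\<dots> = (\<Sum>p\<le>m. (-1) ^ m * (of_nat (r choose (m - p)) * (fact (n + r - 1 + p) / fact p) * w ^ p))"
    by (intro sum.cong refl) (simp add: inner mult_ac)
  also have "\<dots> = (\<Sum>j\<le>m. (-1) ^ m * (of_nat (r choose j) * (fact (n + r - 1 + (m - j)) / fact (m - j)) * w ^ (m - j)))"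
    by (rule sum.reindex_bij_witness[where i = "\<lambda>j. m - j" and j = "\<lambda>j. m - j"]) auto
  \<comment> \<open>The range is cut down to j \<le> r: the terms with j > r have binomial
    coefficient 0.\<close>
  also have "\<dots> = (\<Sum>j\<in>{j\<in>{0..r}. j \<le> m}. (-1) ^ m * (of_nat (r choose j)
        * (fact (m + n + r - 1 - j) / fact (m - j)) * w ^ (m - j)))"
    using n by (intro sum.mono_neutral_cong_right) (auto simp: not_le binomial_eq_0 algebra_simps)
  also have "\<dots> = (-1) ^ m * (\<Sum>j=0..r. if j \<le> m
        then of_nat (r choose j) * (fact (m + n + r - 1 - j) / fact (m - j)) * w ^ (m - j) else 0)"
    by (subst sum.inter_filter) (auto simp: sum_distrib_left intro!: sum.cong)
  finally show ?thesis by (simp add: c_def)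
qed

lemma laguerre_nat:
  assumes "1 \<le> n"
  shows "laguerre (real n - 1) m x
    = (\<Sum>i\<le>m. (-1) ^ i * real ((m + n - 1) choose (m - i)) * x ^ i / fact i)"
  using assms by (simp add: laguerre_def binomial_gbinomial of_nat_diff add_diff_eq)

section \<open>Positive semidefinite square roots\<close>

definition diagm :: "('m \<Rightarrow> real) \<Rightarrow> real^'m^'m" where
  "diagm d = (\<chi> i j. if i = j then d i else 0)"

lemma transpose_diagm [simp]: "transpose (diagm d) = diagm d"
  by (auto simp: diagm_def transpose_def vec_eq_iff)

lemma diagm_mult: "diagm c ** diagm d = diagm (\<lambda>k. c k * d k)"
  by (simp add: diagm_def matrix_matrix_mult_def vec_eq_iff if_distrib[of "\<lambda>c. c * _"] cong: if_cong)

lemma diagm_mult_vec: "diagm d *v x = (\<chi> i. d i * x $ i)"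
  by (simp add: diagm_def matrix_vector_mult_def vec_eq_iff if_distrib[of "\<lambda>c. c * _"] cong: if_cong)

lemma det_diagm: "det (diagm d) = (\<Prod>k\<in>UNIV. d k)"
  unfolding diagm_def by (subst det_diagonal) simp_all

lemma transpose_mult_vec_nth: "(transpose U *v y) $ k = y \<bullet> column k U"
  by (simp add: matrix_vector_mult_def transpose_def column_def inner_vec_def mult.commute)

lemma inner_orthogonal_diagm:
  "((U ** diagm d ** transpose U) *v y) \<bullet> y = (\<Sum>k\<in>UNIV. d k * (y \<bullet> column k U)\<^sup>2)"
proof -
  have "((U ** diagm d ** transpose U) *v y) \<bullet> y
      = y \<bullet> (U *v (diagm d *v (transpose U *v y)))"
    by (simp only: inner_commute matrix_vector_mul_assoc matrix_mul_assoc)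
  also have "\<dots> = (transpose U *v y) \<bullet> (diagm d *v (transpose U *v y))"
    by (simp only: dot_lmul_matrix[symmetric] transpose_matrix_vector)
  also have "\<dots> = (\<Sum>k\<in>UNIV. d k * (y \<bullet> column k U)\<^sup>2)"
    by (simp only: inner_vec_def[of "transpose U *v y"] diagm_mult_vec transpose_mult_vec_nth
        vec_lambda_beta inner_real_def power2_eq_square mult_ac)
  finally show ?thesis .
qed

lemma orthogonal_diagm_square:
  assumes "orthogonal_matrix U"
  shows "(U ** diagm d ** transpose U) ** (U ** diagm d ** transpose U)
    = U ** diagm (\<lambda>k. (d k)\<^sup>2) ** transpose U"
proof -
  have "(U ** diagm d ** transpose U) ** (U ** diagm d ** transpose U)
      = U ** (diagm d ** (transpose U ** U) ** diagm d) ** transpose U"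
    by (simp add: matrix_mul_assoc)
  also have "transpose U ** U = mat 1" using assms by (simp add: orthogonal_matrix)
  finally show ?thesis by (simp add: diagm_mult power2_eq_square)
qed

lemma psd_orthogonal_diagm:
  assumes "\<And>k. 0 \<le> d k"
  shows "psd (U ** diagm d ** transpose U)"
  unfolding psd_def inner_orthogonal_diagm
  by (auto intro!: sum_nonneg simp: assms matrix_transpose_mul matrix_mul_assoc)

text \<open>
  On an eigenvector \<open>x\<close> of \<open>T\<^sup>2\<close> with eigenvalue \<open>d\<^sup>2\<close> one has \<open>(T + d) (T x - d x) = 0\<close>, and \<open>T + d\<close> is
  injective because \<open>T\<close> is positive semidefinite and \<open>d > 0\<close>.
\<close>

lemma psd_root_unique:
  assumes U: "orthogonal_matrix U" and d: "\<And>k. 0 < d k"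
    and T: "psd T" "T ** T = U ** diagm (\<lambda>k. (d k)\<^sup>2) ** transpose U"
  shows "T = U ** diagm d ** transpose U"
proof -
  have UU: "transpose U ** U = mat 1" "U ** transpose U = mat 1"
    using U by (auto simp: orthogonal_matrix_def)
  have col: "(U ** diagm c ** transpose U) *v column k U = c k *\<^sub>R column k U" for c k
  proof -
    have "(U ** diagm c ** transpose U) *v column k U = U *v (diagm c *v ((transpose U ** U) *v axis k 1))"
      by (simp only: matrix_vector_mul_assoc matrix_mul_assoc flip: matrix_vector_mult_basis)
    also have "diagm c *v ((transpose U ** U) *v axis k 1) = c k *\<^sub>R axis k 1"
      by (auto simp: UU diagm_mult_vec vec_eq_iff axis_def)
    finally show ?thesis by (simp add: matrix_vector_mult_scaleR matrix_vector_mult_basis)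
  qed
  have eig: "T *v column k U = d k *\<^sub>R column k U" for k
  proof -
    let ?x = "column k U"
    let ?z = "T *v ?x - d k *\<^sub>R ?x"
    have "T *v (T *v ?x) = (d k)\<^sup>2 *\<^sub>R ?x"
      using col[of "\<lambda>k. (d k)\<^sup>2" k] by (simp add: matrix_vector_mul_assoc T(2))
    then have "T *v ?z = - d k *\<^sub>R ?z"
      by (simp add: matrix_vector_mult_diff_distrib matrix_vector_mult_scaleR algebra_simps power2_eq_square)
    then have "(T *v ?z) \<bullet> ?z = - d k * (?z \<bullet> ?z)"
      by (metis inner_scaleR_left)
    moreover have "0 \<le> (T *v ?z) \<bullet> ?z" using T(1) by (simp add: psd_def)
    ultimately have "?z \<bullet> ?z \<le> 0"
      using d[of k] by (simp add: mult_le_0_iff zero_le_mult_iff)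
    then have "?z \<bullet> ?z = 0" using inner_ge_zero[of ?z] by linarith
    then show ?thesis by (simp only: inner_eq_zero_iff right_minus_eq)
  qed
  have "T ** U = (U ** diagm d ** transpose U) ** U"
  proof -
    have "column k (T ** U) = column k ((U ** diagm d ** transpose U) ** U)" for k
      using eig[of k] col[of d k]
      by (simp only: matrix_vector_mul_assoc flip: matrix_vector_mult_basis)
    then show ?thesis by (simp add: column_def vec_eq_iff)
  qed
  then have "T ** (U ** transpose U) = (U ** diagm d ** transpose U) ** (U ** transpose U)"
    by (simp add: matrix_mul_assoc)
  then show ?thesis by (simp add: UU)
qed

section \<open>From the skew normal form to the square root\<close>

text \<open>Each column of the block matrix has just one nonzero entry, in the row of the other
  member of its pair 2j-1, 2j; \<open>(k + 1) div 2\<close> is the block number j for either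
  member.\<close>

lemma skew_block_eq:
  assumes "1 \<le> i" "1 \<le> k"
  shows "skew_block \<mu> i k = (if i = (if odd k then k + 1 else k - 1)
    then (if odd k then 1 else -1) * \<mu> ((k + 1) div 2) else 0)"
proof (cases "odd k")
  case True
  then show ?thesis using assms by (auto simp: skew_block_def)
next
  case False
  then have "i = k - 1 \<longleftrightarrow> odd i \<and> k = i + 1" "(k + 1) div 2 = k div 2"
    using assms by presburger+
  with False show ?thesis by (simp add: skew_block_def)
qed

text \<open>Distinct columns have their nonzero entries in distinct rows, so the columns of the
  block matrix are orthogonal.\<close>

lemma sum_skew_block_mult:
  assumes k: "k \<in> {1..2*n}" and l: "l \<in> {1..2*n}"
  shows "(\<Sum>i=1..2*n. skew_block \<mu> i k * skew_block \<mu> i l)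
    = (if k = l then (\<mu> ((k + 1) div 2))\<^sup>2 else 0)"
proof -
  define p where "p k = (if odd k then k + 1 else k - 1)" for k :: nat
  define s where "s k = (if odd k then 1 else -1) * \<mu> ((k + 1) div 2)" for k :: nat
  \<comment> \<open>Passing to the partner index stays in range because the upper end 2n is
    even.\<close>
  have p: "p k \<in> {1..2*n}"
    using k unfolding p_def by (auto; presburger)
  have p_inj: "p k = p l \<longleftrightarrow> k = l"
    using k l unfolding p_def by (auto split: if_splits; presburger)
  have sk: "skew_block \<mu> i k = (if i = p k then s k else 0)" if "1 \<le> i" "1 \<le> k" for i k
    using skew_block_eq[OF that] by (simp only: p_def s_def)
  have "(\<Sum>i=1..2*n. skew_block \<mu> i k * skew_block \<mu> i l)
      = (\<Sum>i=1..2*n. if i = p k then s k * (if k = l then s l else 0) else 0)"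
    using k l p_inj by (intro sum.cong refl) (auto simp: sk)
  also have "\<dots> = (if k = l then (\<mu> ((k + 1) div 2))\<^sup>2 else 0)"
    using p by (auto simp: s_def power2_eq_square)
  finally show ?thesis .
qed

lemma sum_pairs:
  fixes g :: "nat \<Rightarrow> 'a::comm_monoid_add"
  shows "(\<Sum>k=1..2*n. g k) = (\<Sum>j=1..n. g (2 * j - 1) + g (2 * j))"
  by (induction n) (simp_all add: add_ac)

lemma prod_pairs:
  fixes g :: "nat \<Rightarrow> 'a::comm_monoid_mult"
  shows "(\<Prod>k=1..2*n. g k) = (\<Prod>j=1..n. g (2 * j - 1) * g (2 * j))"
  by (induction n) (simp_all add: mult_ac)

text \<open>The frame is indexed by 1, ..., 2n and the matrix by the type \<open>'m\<close>; the
  bijection f links the two. With the frame as columns of U one has A = U K U^t for the block matrix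
  K, and the orthogonal columns of K diagonalise A^t A.\<close>

lemma skew_normal_form_diag:
  fixes A :: "real^'m^'m"
  assumes card: "CARD('m) = 2 * n" and nf: "skew_normal_form n A \<mu> v"
  obtains f :: "'m \<Rightarrow> nat" and U where
    "bij_betw f UNIV {1..2*n}" "orthogonal_matrix U" "\<And>k. column k U = v (f k)"
    "transpose A ** A = U ** diagm (\<lambda>k. (\<mu> ((f k + 1) div 2))\<^sup>2) ** transpose U"
proof -
  obtain f :: "'m \<Rightarrow> nat" where f: "bij_betw f UNIV {1..2*n}"
    using finite_same_card_bij[of "UNIV :: 'm set" "{1..2*n}"] card by auto
  have fk: "f k \<in> {1..2*n}" for k using f by (auto dest: bij_betwE)
  have finj: "f k = f l \<longleftrightarrow> k = l" for k l
    using f by (auto simp: bij_betw_def inj_on_def)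
  define U where "U = (\<chi> i k. v (f k) $ i)"
  define K where "K = (\<chi> k l. skew_block \<mu> (f k) (f l))"
  have col: "column k U = v (f k)" for k by (simp add: U_def column_def vec_eq_iff)
  have nf': "v (f k) \<bullet> v (f l) = (if k = l then 1 else 0)"
       "v (f k) \<bullet> (A *v v (f l)) = skew_block \<mu> (f k) (f l)" for k l
    using nf fk finj unfolding skew_normal_form_def by auto
  have UU: "transpose U ** U = mat 1"
    unfolding matrix_mult_transpose_dot_column col by (auto simp: nf' mat_def vec_eq_iff)
  then have orth: "orthogonal_matrix U" by (simp add: orthogonal_matrix)
  then have UU': "U ** transpose U = mat 1" by (simp add: orthogonal_matrix_def)
  have K: "transpose U ** (A ** U) = K"
  proof -
    have "(transpose U ** (A ** U)) $ k $ l = column k U \<bullet> (A *v column l U)" for k l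
      by (simp add: matrix_matrix_mult_def transpose_def column_def inner_vec_def matrix_vector_mult_def)
    then show ?thesis by (simp add: vec_eq_iff col nf' K_def)
  qed
  have "A = (U ** transpose U) ** A ** (U ** transpose U)" by (simp add: UU')
  also have "\<dots> = U ** K ** transpose U" by (simp add: matrix_mul_assoc flip: K)
  finally have A: "A = U ** K ** transpose U" .
  have "transpose A ** A = U ** (transpose K ** (transpose U ** U) ** K) ** transpose U"
    by (simp add: A matrix_transpose_mul matrix_mul_assoc)
  also have "transpose K ** (transpose U ** U) ** K = diagm (\<lambda>k. (\<mu> ((f k + 1) div 2))\<^sup>2)"
  proof -
    have "(transpose K ** K) $ k $ l = diagm (\<lambda>k. (\<mu> ((f k + 1) div 2))\<^sup>2) $ k $ l" for k l
    proof -
      have "(transpose K ** K) $ k $ l = (\<Sum>i\<in>UNIV. skew_block \<mu> (f i) (f k) * skew_block \<mu> (f i) (f l))"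
        by (simp add: matrix_matrix_mult_def transpose_def K_def)
      also have "\<dots> = (\<Sum>i=1..2*n. skew_block \<mu> i (f k) * skew_block \<mu> i (f l))"
        by (rule sum.reindex_bij_betw[OF f])
      finally show ?thesis by (simp only: sum_skew_block_mult[OF fk fk] finj) (simp add: diagm_def)
    qed
    then show ?thesis by (simp add: UU vec_eq_iff)
  qed
  finally show ?thesis using that f orth col by blast
qed

text \<open>\<open>U ** diagm d ** transpose U\<close> is a positive root of A^t A and, by
  \<open>psd_root_unique\<close>, the only one, so the \<open>THE\<close> in \<open>psd_sqrt\<close>
  denotes it. Each \<mu> j belongs to two frame vectors: they combine to \<open>pair_normsq\<close>
  in the quadratic form and make the determinant a square.\<close>

lemma skew_normal_form_psd_sqrt:
  fixes A :: "real^'m^'m"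
  assumes card: "CARD('m) = 2 * n" and nf: "skew_normal_form n A \<mu> v"
  defines "S \<equiv> psd_sqrt (transpose A ** A)"
  shows "psd S" "S ** S = transpose A ** A"
    and "\<And>T. psd T \<Longrightarrow> T ** T = transpose A ** A \<Longrightarrow> T = S"
    and "(S *v y) \<bullet> y = (\<Sum>j=1..n. \<mu> j * pair_normsq v y j)"
    and "y \<noteq> 0 \<Longrightarrow> 0 < (S *v y) \<bullet> y"
    and "sqrt (det S) = (\<Prod>j=1..n. \<mu> j)"
proof -
  obtain f :: "'m \<Rightarrow> nat" and U where f: "bij_betw f UNIV {1..2*n}" and U: "orthogonal_matrix U"
    and col: "\<And>k. column k U = v (f k)"
    and AA: "transpose A ** A = U ** diagm (\<lambda>k. (\<mu> ((f k + 1) div 2))\<^sup>2) ** transpose U"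
    using skew_normal_form_diag[OF card nf] by blast
  define d where "d k = \<mu> ((f k + 1) div 2)" for k
  have AA': "transpose A ** A = U ** diagm (\<lambda>k. (d k)\<^sup>2) ** transpose U"
    by (simp add: AA d_def)
  let ?R = "U ** diagm d ** transpose U"
  have pos: "0 < \<mu> j" if "j \<in> {1..n}" for j
    using nf that by (auto simp: skew_normal_form_def)
  have d: "0 < d k" for k
  proof -
    have "f k \<in> {1..2*n}" using f by (auto dest: bij_betwE)
    then show ?thesis unfolding d_def by (intro pos) auto
  qed
  have R: "psd ?R" "?R ** ?R = transpose A ** A"
    using psd_orthogonal_diagm[of d U] orthogonal_diagm_square[OF U, of d] d
    by (auto simp: AA' less_imp_le)
  have uniq: "T = ?R" if "psd T" "T ** T = transpose A ** A" for T
    by (rule psd_root_unique[OF U d that(1) that(2)[unfolded AA']])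
  have S: "S = ?R"
    unfolding S_def psd_sqrt_def using R uniq by (intro the_equality) blast+
  show "psd S" "S ** S = transpose A ** A" using R by (simp_all add: S)
  show "T = S" if "psd T" "T ** T = transpose A ** A" for T unfolding S by (rule uniq[OF that])
  have quad: "(S *v y) \<bullet> y = (\<Sum>k\<in>UNIV. d k * (y \<bullet> v (f k))\<^sup>2)"
    unfolding S inner_orthogonal_diagm col ..
  also have "\<dots> = (\<Sum>k=1..2*n. \<mu> ((k + 1) div 2) * (y \<bullet> v k)\<^sup>2)"
    unfolding d_def by (rule sum.reindex_bij_betw[OF f])
  also have "\<dots> = (\<Sum>j=1..n. \<mu> j * pair_normsq v y j)"
    unfolding sum_pairs by (intro sum.cong refl) (simp add: pair_normsq_def algebra_simps)
  finally show "(S *v y) \<bullet> y = (\<Sum>j=1..n. \<mu> j * pair_normsq v y j)" .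
  show "0 < (S *v y) \<bullet> y" if "y \<noteq> 0"
  proof -
    have "\<exists>k. y \<bullet> v (f k) \<noteq> 0"
    proof (rule ccontr)
      assume "\<nexists>k. y \<bullet> v (f k) \<noteq> 0"
      then have "transpose U *v y = 0"
        unfolding vec_eq_iff transpose_mult_vec_nth col by simp
      then have "(U ** transpose U) *v y = 0" by (simp flip: matrix_vector_mul_assoc)
      then show False using U \<open>y \<noteq> 0\<close> by (simp add: orthogonal_matrix_def)
    qed
    then obtain k where "y \<bullet> v (f k) \<noteq> 0" ..
    then show ?thesis unfolding quad using d
      by (intro sum_pos2[of _ k]) (auto simp: less_imp_le)
  qed
  have "(det U)\<^sup>2 = 1" using det_orthogonal_matrix[OF U] by auto
  then have "det S = (\<Prod>k\<in>UNIV. d k)"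
    by (simp add: S det_mul det_transpose det_diagm power2_eq_square)
  also have "\<dots> = (\<Prod>k=1..2*n. \<mu> ((k + 1) div 2))"
    unfolding d_def by (rule prod.reindex_bij_betw[OF f])
  also have "\<dots> = (\<Prod>j=1..n. \<mu> j)\<^sup>2"
    unfolding prod_pairs power2_eq_square prod.distrib[symmetric] by (intro prod.cong refl) auto
  finally have "det S = (\<Prod>j=1..n. \<mu> j)\<^sup>2" .
  moreover have "0 < (\<Prod>j=1..n. \<mu> j)" by (intro prod_pos) (simp add: pos)
  ultimately show "sqrt (det S) = (\<Prod>j=1..n. \<mu> j)" by simp
qed

text \<open>For a symmetric root S of A this expresses the Frobenius norm of S by the trace of A,
  hence bounds roots uniformly over a compact set.\<close>

lemma trace_mult_transpose: "trace (S ** transpose S) = (norm S)\<^sup>2" for S :: "real^'m^'m"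
proof -
  have "trace (S ** transpose S) = (\<Sum>i\<in>UNIV. \<Sum>k\<in>UNIV. S $ i $ k * S $ i $ k)"
    by (simp only: trace_def matrix_matrix_mult_def transpose_def vec_lambda_beta)
  also have "\<dots> = S \<bullet> S"
    by (simp only: inner_vec_def inner_real_def)
  finally show ?thesis by (simp only: power2_norm_eq_inner)
qed

section \<open>Continuity and homogeneity of the square root\<close>

lemma continuous_on_matrix_mult:
  fixes f g :: "'a::topological_space \<Rightarrow> real^'m^'m"
  assumes "continuous_on X f" "continuous_on X g"
  shows "continuous_on X (\<lambda>x. f x ** g x)"
  unfolding matrix_matrix_mult_def
  by (intro continuous_on_vec_lambda continuous_on_sum continuous_on_mult continuous_on_component assms)

lemma continuous_on_transpose:
  fixes f :: "'a::topological_space \<Rightarrow> real^'m^'m"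
  assumes "continuous_on X f"
  shows "continuous_on X (\<lambda>x. transpose (f x))"
  unfolding transpose_def
  by (intro continuous_on_vec_lambda continuous_on_component assms)

lemma continuous_on_matrix_vector:
  fixes f :: "'a::topological_space \<Rightarrow> real^'m^'m"
  assumes "continuous_on X f"
  shows "continuous_on X (\<lambda>x. f x *v y)"
  unfolding matrix_vector_mult_def
  by (intro continuous_on_vec_lambda continuous_on_sum continuous_on_mult continuous_on_component
      continuous_on_const assms)

lemma continuous_on_det:
  fixes f :: "'a::topological_space \<Rightarrow> real^'m^'m"
  assumes "continuous_on X f"
  shows "continuous_on X (\<lambda>x. det (f x))"
  unfolding det_def
  by (intro continuous_on_sum continuous_on_mult continuous_on_prod continuous_on_component
      continuous_on_const assms)

lemma closed_psd: "closed {S :: real^'m^'m. psd S}"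
  unfolding psd_def
  by (intro closed_Collect_conj closed_Collect_all closed_Collect_eq closed_Collect_le
      continuous_intros continuous_on_transpose continuous_on_matrix_vector)

text \<open>By uniqueness the graph of S is cut out by two closed conditions: T is positive
  semidefinite and T T = A x. The trace of A bounds S on K, and a map into a compact set with closed
  graph is continuous.\<close>

lemma continuous_on_psd_root:
  fixes A S :: "'a::euclidean_space \<Rightarrow> real^'m^'m"
  assumes K: "compact K" and A: "continuous_on K A"
    and S: "\<And>x. x \<in> K \<Longrightarrow> psd (S x)" "\<And>x. x \<in> K \<Longrightarrow> S x ** S x = A x"
    and uniq: "\<And>x T. x \<in> K \<Longrightarrow> psd T \<Longrightarrow> T ** T = A x \<Longrightarrow> T = S x"
  shows "continuous_on K S"
proof -
  have "continuous_on K (\<lambda>x. trace (A x))"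
    unfolding trace_def using A by (intro continuous_intros)
  then have "bounded ((\<lambda>x. trace (A x)) ` K)"
    using K by (intro compact_imp_bounded compact_continuous_image)
  then obtain M where M: "\<And>x. x \<in> K \<Longrightarrow> \<bar>trace (A x)\<bar> \<le> M"
    by (auto simp: bounded_iff)
  have "norm (S x) \<le> sqrt M" if "x \<in> K" for x
  proof -
    have "(norm (S x))\<^sup>2 = trace (A x)"
      using S[OF that] by (simp add: psd_def flip: trace_mult_transpose)
    then show ?thesis using M[OF that] by (intro real_le_rsqrt) auto
  qed
  then have ball: "S \<in> K \<rightarrow> cball 0 (sqrt M)" by auto
  have "(\<lambda>x. (x, S x)) ` K = (K \<times> {S. psd S}) \<inter> (\<lambda>p. snd p ** snd p - A (fst p)) -` {0}"
    using S uniq by force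
  moreover have "closed \<dots>"
  proof (rule continuous_closed_preimage)
    show "continuous_on (K \<times> {S. psd S}) (\<lambda>p. snd p ** snd p - A (fst p))"
      by (intro continuous_intros continuous_on_matrix_mult continuous_on_compose2[OF A]) auto
    show "closed (K \<times> {S :: real^'m^'m. psd S})"
      by (rule closed_Times[OF compact_imp_closed[OF K] closed_psd])
  qed simp
  ultimately show ?thesis
    using continuous_from_closed_graph[OF compact_cball ball] by simp
qed

lemma Bmat_scaleR: "Bmat B (c *\<^sub>R \<tau>) = c *\<^sub>R Bmat B \<tau>"
  by (simp add: Bmat_def scaleR_sum_right)

lemma continuous_on_Bmat: "continuous_on X (Bmat B)"
  unfolding Bmat_def by (intro continuous_intros)

lemma psd_scaleR: "psd S \<Longrightarrow> 0 \<le> c \<Longrightarrow> psd (c *\<^sub>R S)"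
  by (auto simp: psd_def transpose_scalar scaleR_matrix_vector_assoc[symmetric])

lemma det_scaleR: "det (c *\<^sub>R A) = c ^ CARD('m) * det A" for A :: "real^'m^'m"
proof -
  have "c *\<^sub>R A = (\<chi> i. c *s A $ i)" by (simp add: vec_eq_iff)
  then show ?thesis using det_rows_mul[of "\<lambda>_. c" "\<lambda>i. A $ i"] by simp
qed

context
  fixes B :: "real^'m \<Rightarrow> real^'m \<Rightarrow> real^'r" and n \<mu> v
  assumes card: "CARD('m) = 2 * n" and frame: "admissible_frame n B \<mu> v"
begin

lemma frame_normal_form: "\<tau> \<noteq> 0 \<Longrightarrow> skew_normal_form n (Bmat B \<tau>) (\<mu> \<tau>) (v \<tau>)"
  using frame by (simp add: admissible_frame_def)

lemmas Babs_facts = skew_normal_form_psd_sqrt[OF card frame_normal_form, folded Babs_def]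

text \<open>The right side is a positive semidefinite root for the scaled matrix, so uniqueness
  identifies it.\<close>

lemma Babs_scaleR:
  assumes "0 < c" "\<tau> \<noteq> 0"
  shows "Babs B (c *\<^sub>R \<tau>) = c *\<^sub>R Babs B \<tau>"
  using assms
  by (intro Babs_facts(3)[symmetric])
     (auto simp: psd_scaleR Babs_facts Bmat_scaleR transpose_scalar matrix_scalar_ac simp flip: scalar_matrix_assoc)

text \<open>The sphere supplies both the compactness for the closed graph argument and \<tau>
  \<noteq> 0.\<close>

lemma continuous_on_Babs: "continuous_on (sphere 0 1) (Babs B)"
  by (rule continuous_on_psd_root[where A = "\<lambda>\<tau>. transpose (Bmat B \<tau>) ** Bmat B \<tau>"])
     (auto intro!: Babs_facts continuous_on_matrix_mult continuous_on_transpose continuous_on_Bmat)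

end

section \<open>Polar coordinates\<close>

lemma sets_sphere_measure [measurable_cong]:
  "sets (sphere_measure :: 'a::euclidean_space measure) = sets (restrict_space borel (sphere 0 1))"
  by (simp add: sphere_measure_def)

lemma nn_integral_sphere_measure:
  fixes g :: "'a::euclidean_space \<Rightarrow> ennreal"
  assumes g [measurable]: "g \<in> borel_measurable borel"
  shows "(\<integral>\<^sup>+\<sigma>. g \<sigma> \<partial>sphere_measure)
    = of_nat DIM('a) * (\<integral>\<^sup>+x. g (x /\<^sub>R norm x) * indicator (cball 0 1 - {0}) x \<partial>lborel)"
proof -
  let ?M = "restrict_space (lborel :: 'a measure) (cball 0 1 - {0})"
  let ?S = "restrict_space borel (sphere 0 1) :: 'a measure"
  have p: "(\<lambda>x::'a. x /\<^sub>R norm x) \<in> measurable ?M ?S"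
    by (rule measurable_restrict_space2)
       (auto simp: space_restrict_space intro!: measurable_restrict_space1)
  have gS: "g \<in> borel_measurable ?S" by (intro measurable_restrict_space1 g)
  then show ?thesis
    unfolding sphere_measure_def using p
    by (simp add: nn_integral_scale_measure nn_integral_distr nn_integral_restrict_space)
qed

lemma finite_measure_sphere_measure: "finite_measure (sphere_measure :: 'a::euclidean_space measure)"
proof
  let ?C = "{s *\<^sub>R x | s x. 0 < s \<and> s \<le> 1 \<and> x \<in> sphere 0 1} :: 'a set"
  have "emeasure lborel ?C \<le> emeasure lborel (cball 0 1 :: 'a set)"
    by (intro emeasure_mono) auto
  also have "\<dots> < \<infinity>" by (rule emeasure_lborel_cball_finite)
  finally have "emeasure lborel ?C < \<infinity>" .
  then show "emeasure sphere_measure (space (sphere_measure :: 'a measure)) \<noteq> \<infinity>"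
    by (simp add: space_sphere_measure emeasure_sphere_measure ennreal_mult_eq_top_iff)
qed

definition radial_measure :: "nat \<Rightarrow> real measure" where
  "radial_measure d = density lborel (\<lambda>s. ennreal (s ^ (d - 1)) * indicator {0<..} s)"

lemma sets_radial_measure [simp, measurable_cong]: "sets (radial_measure d) = sets borel"
  by (simp add: radial_measure_def)

lemma space_radial_measure [simp]: "space (radial_measure d) = UNIV"
  by (simp add: radial_measure_def)

lemma sigma_finite_radial_measure: "sigma_finite_measure (radial_measure d)"
  unfolding radial_measure_def
  by (subst sigma_finite_measure.sigma_finite_iff_density_finite[OF sigma_finite_lborel])
     (auto simp: indicator_def ennreal_mult_eq_top_iff)

lemma nn_integral_radial_measure:
  assumes [measurable]: "h \<in> borel_measurable borel"
  shows "(\<integral>\<^sup>+s. h s \<partial>radial_measure d)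
    = (\<integral>\<^sup>+s. ennreal (s ^ (d - 1)) * indicator {0<..} s * h s \<partial>lborel)"
  unfolding radial_measure_def by (subst nn_integral_density) auto

text \<open>Substitute c s for s: the weight gives c^(d-1) and ds another c, which is c^d as
  \<open>1 \<le> d\<close>. In the polar formula this removes the normalisation x / |x|.\<close>

lemma nn_integral_radial_measure_scale:
  assumes [measurable]: "h \<in> borel_measurable borel" and c: "0 < c" and d: "1 \<le> d"
  shows "(\<integral>\<^sup>+s. h s \<partial>radial_measure d) = ennreal (c ^ d) * (\<integral>\<^sup>+s. h (c * s) \<partial>radial_measure d)"
proof -
  have cd: "c * (c * s) ^ (d - 1) = c ^ d * s ^ (d - 1)" for s
    using d by (cases d) (auto simp: power_mult_distrib)
  have "(\<integral>\<^sup>+s. h s \<partial>radial_measure d)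
      = ennreal c * (\<integral>\<^sup>+s. ennreal ((c * s) ^ (d - 1)) * indicator {0<..} (c * s) * h (c * s) \<partial>lborel)"
    using c by (subst nn_integral_radial_measure, simp, subst nn_integral_real_affine[of _ c 0]) auto
  also have "\<dots> = (\<integral>\<^sup>+s. ennreal (c ^ d) * (ennreal (s ^ (d - 1)) * indicator {0<..} s * h (c * s)) \<partial>lborel)"
    using c
    by (subst nn_integral_cmult[symmetric], simp, intro nn_integral_cong)
       (auto simp: indicator_def zero_less_mult_iff cd simp del: One_nat_def simp flip: mult.assoc ennreal_mult')
  also have "\<dots> = ennreal (c ^ d) * (\<integral>\<^sup>+s. h (c * s) \<partial>radial_measure d)"
    by (simp add: nn_integral_cmult nn_integral_radial_measure)
  finally show ?thesis .
qed

lemma nn_integral_lborel_scaleR: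
  fixes f :: "'a::euclidean_space \<Rightarrow> ennreal"
  assumes [measurable]: "f \<in> borel_measurable borel" and c: "0 < c"
  shows "(\<integral>\<^sup>+x. f x \<partial>lborel) = ennreal (c ^ DIM('a)) * (\<integral>\<^sup>+x. f (c *\<^sub>R x) \<partial>lborel)"
  using c by (subst lborel_affine[of c 0])
    (auto simp: nn_integral_density nn_integral_distr nn_integral_cmult)

text \<open>The antiderivative is -1/(d s^d); its denominator cancels the dimension factor in
  \<open>sphere_measure\<close>.\<close>

lemma nn_integral_power_tail:
  assumes a: "0 < a" and d: "1 \<le> d"
  shows "ennreal (real d) * (\<integral>\<^sup>+s. ennreal (1 / s ^ (d + 1)) * indicator {a..} s \<partial>lborel)
    = ennreal (1 / a ^ d)"
proof -
  have lim: "((\<lambda>s::real. - (1 / (real d * s ^ d))) \<longlongrightarrow> 0) at_top"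
  proof -
    have "filterlim (\<lambda>s::real. real d * s ^ d) at_top at_top"
      using d by (intro filterlim_tendsto_pos_mult_at_top[OF tendsto_const] filterlim_pow_at_top filterlim_ident) auto
    then have "((\<lambda>s::real. inverse (real d * s ^ d)) \<longlongrightarrow> 0) at_top"
      by (intro tendsto_inverse_0_at_top)
    from tendsto_minus[OF this] show ?thesis by (simp add: divide_inverse)
  qed
  have der: "((\<lambda>s. - (1 / (real d * s ^ d))) has_real_derivative 1 / s ^ (d + 1)) (at s)"
    if "a \<le> s" for s
  proof -
    have "s > 0" using a that by simp
    then show ?thesis using d
      by (auto intro!: derivative_eq_intros simp: field_simps power_diff)
  qed
  have "(\<integral>\<^sup>+s. ennreal (1 / s ^ (d + 1)) * indicator {a..} s \<partial>lborel)
      = ennreal (0 - - (1 / (real d * a ^ d)))"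
    using a by (intro nn_integral_FTC_atLeast[OF _ der _ lim]) auto
  then show ?thesis using a d by (simp flip: ennreal_mult')
qed

text \<open>
  By definition the left-hand side is \<open>d\<close> times an integral over the unit ball, in \<open>x\<close>. Substituting
  \<open>s |x|\<close> for \<open>s\<close> and then \<open>u = s x\<close> leaves \<open>f u |u|\<^sup>d\<close> times \<open>d s\<^bsup>-d-1\<^esup>\<close> integrated over \<open>s \<ge> |u|\<close>,
  which is \<open>f u\<close>.
\<close>

lemma nn_integral_polar:
  fixes f :: "'a::euclidean_space \<Rightarrow> ennreal"
  assumes [measurable]: "f \<in> borel_measurable borel"
  shows "(\<integral>\<^sup>+\<sigma>. \<integral>\<^sup>+s. f (s *\<^sub>R \<sigma>) \<partial>radial_measure DIM('a) \<partial>sphere_measure) = (\<integral>\<^sup>+x. f x \<partial>lborel)"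
proof -
  let ?d = "DIM('a)"
  let ?R = "radial_measure ?d"
  \<comment> \<open>Under u = s x the condition |x| \<le> 1 becomes |u| \<le> s. The factor |x|^d =
    |u|^d / s^d, the radial weight s^(d-1) and the Jacobian s^(-d) together leave |u|^d /
    s^(d+1).\<close>
  let ?k = "\<lambda>a s. if a \<le> s then ennreal (1 / s ^ (?d + 1)) else 0"
  define D where "D = cball 0 1 - {0 :: 'a}"
  have [measurable]: "D \<in> sets borel" by (simp add: D_def)
  interpret R: sigma_finite_measure ?R by (rule sigma_finite_radial_measure)
  interpret PL: pair_sigma_finite "lborel :: 'a measure" ?R ..
  have d: "1 \<le> ?d" by (simp add: Suc_leI)
  have "(\<integral>\<^sup>+\<sigma>. \<integral>\<^sup>+s. f (s *\<^sub>R \<sigma>) \<partial>?R \<partial>sphere_measure)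
      = of_nat ?d * (\<integral>\<^sup>+x. (\<integral>\<^sup>+s. f (s *\<^sub>R (x /\<^sub>R norm x)) \<partial>?R) * indicator D x \<partial>lborel)"
    unfolding D_def by (rule nn_integral_sphere_measure) measurable
  also have "(\<integral>\<^sup>+x. (\<integral>\<^sup>+s. f (s *\<^sub>R (x /\<^sub>R norm x)) \<partial>?R) * indicator D x \<partial>lborel)
      = (\<integral>\<^sup>+x. \<integral>\<^sup>+s. ennreal (norm x ^ ?d) * f (s *\<^sub>R x) * indicator D x \<partial>?R \<partial>lborel)"
  proof (rule nn_integral_cong)
    fix x :: 'a
    show "(\<integral>\<^sup>+s. f (s *\<^sub>R (x /\<^sub>R norm x)) \<partial>?R) * indicator D x
        = (\<integral>\<^sup>+s. ennreal (norm x ^ ?d) * f (s *\<^sub>R x) * indicator D x \<partial>?R)"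
    proof (cases "x = 0")
      case False
      then have "(\<integral>\<^sup>+s. f (s *\<^sub>R (x /\<^sub>R norm x)) \<partial>?R)
          = ennreal (norm x ^ ?d) * (\<integral>\<^sup>+s. f ((norm x * s) *\<^sub>R (x /\<^sub>R norm x)) \<partial>?R)"
        by (intro nn_integral_radial_measure_scale d) auto
      also have "(\<lambda>s. (norm x * s) *\<^sub>R (x /\<^sub>R norm x)) = (\<lambda>s. s *\<^sub>R x)"
        using False by (simp add: fun_eq_iff)
      finally show ?thesis by (simp add: nn_integral_cmult nn_integral_multc)
    qed (simp add: D_def)
  qed
  also have "\<dots> = (\<integral>\<^sup>+s. \<integral>\<^sup>+x. ennreal (norm x ^ ?d) * f (s *\<^sub>R x) * indicator D x \<partial>lborel \<partial>?R)"
    by (rule PL.Fubini'[symmetric]) measurable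
  also have "\<dots> = (\<integral>\<^sup>+s. \<integral>\<^sup>+u. ?k (norm u) s
      * (ennreal (norm u ^ ?d) * f u * indicator (- {0}) u) \<partial>lborel \<partial>lborel)"
  proof (subst nn_integral_radial_measure, measurable, rule nn_integral_cong)
    fix s :: real
    show "ennreal (s ^ (?d - 1)) * indicator {0<..} s
        * (\<integral>\<^sup>+x. ennreal (norm x ^ ?d) * f (s *\<^sub>R x) * indicator D x \<partial>lborel)
      = (\<integral>\<^sup>+u. ?k (norm u) s
      * (ennreal (norm u ^ ?d) * f u * indicator (- {0}) u) \<partial>lborel)"
    proof (cases "0 < s")
      case True
      have "(\<integral>\<^sup>+u. ?k (norm u) s
          * (ennreal (norm u ^ ?d) * f u * indicator (- {0}) u) \<partial>lborel)
        = ennreal (s ^ ?d) * (\<integral>\<^sup>+x. ?k (norm (s *\<^sub>R x)) s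
          * (ennreal (norm (s *\<^sub>R x) ^ ?d) * f (s *\<^sub>R x) * indicator (- {0}) (s *\<^sub>R x)) \<partial>lborel)"
        by (rule nn_integral_lborel_scaleR) (use True in measurable)
      also have "\<dots> = (\<integral>\<^sup>+x. ennreal (s ^ (?d - 1)) * (ennreal (norm x ^ ?d) * f (s *\<^sub>R x) * indicator D x) \<partial>lborel)"
      proof (subst nn_integral_cmult[symmetric], measurable, rule nn_integral_cong)
        fix x :: 'a
        have "s ^ ?d * (1 / s ^ (?d + 1) * (norm (s *\<^sub>R x)) ^ ?d) = s ^ (?d - 1) * norm x ^ ?d"
          using True d by (cases ?d) (auto simp: power_mult_distrib field_simps)
        then have "ennreal (s ^ ?d) * (ennreal (1 / s ^ (?d + 1)) * ennreal ((norm (s *\<^sub>R x)) ^ ?d))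
            = ennreal (s ^ (?d - 1)) * ennreal (norm x ^ ?d)"
          using True by (simp flip: ennreal_mult')
        moreover have "norm (s *\<^sub>R x) \<le> s \<and> s *\<^sub>R x \<in> - {0} \<longleftrightarrow> x \<in> D"
          using True by (auto simp: D_def)
        ultimately show "ennreal (s ^ ?d) * (?k (norm (s *\<^sub>R x)) s
            * (ennreal (norm (s *\<^sub>R x) ^ ?d) * f (s *\<^sub>R x) * indicator (- {0}) (s *\<^sub>R x)))
          = ennreal (s ^ (?d - 1)) * (ennreal (norm x ^ ?d) * f (s *\<^sub>R x) * indicator D x)"
          by (auto simp: indicator_def simp flip: mult.assoc)
      qed
      also have "\<dots> = ennreal (s ^ (?d - 1)) * indicator {0<..} s
        * (\<integral>\<^sup>+x. ennreal (norm x ^ ?d) * f (s *\<^sub>R x) * indicator D x \<partial>lborel)"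
        using True by (subst nn_integral_cmult) auto
      finally show ?thesis by simp
    next
      case False
      \<comment> \<open>For s \<le> 0 the condition |u| \<le> s admits at most u = 0, which the
        indicator removes.\<close>
      then have "(\<lambda>u::'a. ?k (norm u) s
          * (ennreal (norm u ^ ?d) * f u * indicator (- {0}) u)) = (\<lambda>_. 0)"
        by (auto simp: fun_eq_iff indicator_def) (meson norm_le_zero_iff order_trans not_less)
      then show ?thesis using False by simp
    qed
  qed
  also have "\<dots> = (\<integral>\<^sup>+u. \<integral>\<^sup>+s. ?k (norm u) s
      * (ennreal (norm u ^ ?d) * f u * indicator (- {0}) u) \<partial>lborel \<partial>lborel)"
    by (rule lborel_pair.Fubini') measurable
  also have "of_nat ?d * \<dots> = (\<integral>\<^sup>+u. ennreal (real ?d) * (\<integral>\<^sup>+s. ?k (norm u) s \<partial>lborel)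
      * (ennreal (norm u ^ ?d) * f u * indicator (- {0}) u) \<partial>lborel)"
    by (subst nn_integral_cmult[symmetric])
       (auto simp: nn_integral_multc mult.assoc ennreal_of_nat_eq_real_of_nat)
  also have "\<dots> = (\<integral>\<^sup>+u. f u * indicator (- {0}) u \<partial>lborel)"
  proof (rule nn_integral_cong)
    fix u :: 'a
    show "ennreal (real ?d) * (\<integral>\<^sup>+s. ?k (norm u) s \<partial>lborel)
      * (ennreal (norm u ^ ?d) * f u * indicator (- {0}) u) = f u * indicator (- {0}) u"
    proof (cases "u = 0")
      case False
      then have "ennreal (1 / norm u ^ ?d) * ennreal (norm u ^ ?d) = 1"
        by (simp flip: ennreal_mult')
      moreover have "(\<integral>\<^sup>+s. ?k (norm u) s \<partial>lborel)
          = (\<integral>\<^sup>+s. ennreal (1 / s ^ (?d + 1)) * indicator {norm u..} s \<partial>lborel)"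
        by (intro nn_integral_cong) (simp add: indicator_def)
      ultimately show ?thesis
        using nn_integral_power_tail[OF _ d, of "norm u"] False by (simp flip: mult.assoc)
    qed simp
  qed
  also have "\<dots> = (\<integral>\<^sup>+x. f x \<partial>lborel)"
    by (rule nn_integral_cong_AE, rule eventually_mono[OF AE_lborel_singleton[of 0]]) simp
  finally show ?thesis .
qed

lemma measurable_polar [measurable]:
  "(\<lambda>(\<sigma>, s). s *\<^sub>R \<sigma>) \<in> sphere_measure \<Otimes>\<^sub>M radial_measure d \<rightarrow>\<^sub>M (borel :: 'a::euclidean_space measure)"
proof -
  have [measurable]: "(\<lambda>x. x) \<in> (sphere_measure :: 'a measure) \<rightarrow>\<^sub>M borel"
    by (simp add: measurable_cong_sets[OF sets_sphere_measure refl] measurable_restrict_space1)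
  show ?thesis by measurable
qed

text \<open>Applying \<open>nn_integral_polar\<close> to indicators exhibits Lebesgue measure as an
  image measure, which carries the polar formula over to vector-valued integrals.\<close>

lemma distr_polar:
  "distr (sphere_measure \<Otimes>\<^sub>M radial_measure DIM('a)) borel (\<lambda>(\<sigma>, s). s *\<^sub>R \<sigma>)
    = (lborel :: 'a::euclidean_space measure)"
proof (rule measure_eqI)
  interpret R: sigma_finite_measure "radial_measure DIM('a)" by (rule sigma_finite_radial_measure)
  fix A :: "'a set"
  assume "A \<in> sets (distr (sphere_measure \<Otimes>\<^sub>M radial_measure DIM('a)) borel (\<lambda>(\<sigma>, s). s *\<^sub>R \<sigma>))"
  then have A [measurable]: "A \<in> sets borel" by simp
  have "emeasure (distr (sphere_measure \<Otimes>\<^sub>M radial_measure DIM('a)) borel (\<lambda>(\<sigma>, s). s *\<^sub>R \<sigma>)) A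
      = (\<integral>\<^sup>+p. indicator A (snd p *\<^sub>R fst p) \<partial>(sphere_measure \<Otimes>\<^sub>M radial_measure DIM('a)))"
    by (simp add: nn_integral_distr case_prod_beta flip: nn_integral_indicator)
  also have "\<dots> = (\<integral>\<^sup>+\<sigma>. \<integral>\<^sup>+s. indicator A (s *\<^sub>R \<sigma>) \<partial>radial_measure DIM('a) \<partial>sphere_measure)"
    using measurable_polar by (subst R.nn_integral_fst[symmetric]) (auto simp: case_prod_beta)
  also have "\<dots> = emeasure lborel A" by (simp add: nn_integral_polar)
  finally show "emeasure (distr (sphere_measure \<Otimes>\<^sub>M radial_measure DIM('a)) borel (\<lambda>(\<sigma>, s). s *\<^sub>R \<sigma>)) A
      = emeasure lborel A" .
qed simp

lemma integral_polar:
  fixes f :: "'a::euclidean_space \<Rightarrow> 'b::{banach, second_countable_topology}"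
  assumes f [measurable]: "f \<in> borel_measurable borel"
    and int: "integrable (sphere_measure \<Otimes>\<^sub>M radial_measure DIM('a)) (\<lambda>(\<sigma>, s). f (s *\<^sub>R \<sigma>))"
  shows "integral\<^sup>L lborel f
    = (LINT \<sigma>|sphere_measure. LINT s|radial_measure DIM('a). f (s *\<^sub>R \<sigma>))"
proof -
  interpret R: sigma_finite_measure "radial_measure DIM('a)" by (rule sigma_finite_radial_measure)
  interpret S: finite_measure "sphere_measure :: 'a measure" by (rule finite_measure_sphere_measure)
  interpret P: pair_sigma_finite "sphere_measure :: 'a measure" "radial_measure DIM('a)" ..
  have "integral\<^sup>L lborel f
      = (LINT p|(sphere_measure \<Otimes>\<^sub>M radial_measure DIM('a)). f ((\<lambda>(\<sigma>, s). s *\<^sub>R \<sigma>) p))"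
    unfolding distr_polar[symmetric] by (rule integral_distr) auto
  also have "\<dots> = (LINT \<sigma>|sphere_measure. LINT s|radial_measure DIM('a). f (s *\<^sub>R \<sigma>))"
    using P.integral_fst[OF int] by (simp add: case_prod_unfold)
  finally show ?thesis .
qed

section \<open>Laplace transforms of powers\<close>

text \<open>Since exp (-z s) has modulus exp (- Re z s), the integrand has the modulus of a Gamma
  integrand. The Gamma integral is over the completed measure and passes to \<open>lborel\<close>
  because the integrand is Borel.\<close>

lemma set_integrable_power_exp:
  fixes z :: complex
  assumes z: "0 < Re z"
  shows "set_integrable lborel {0<..} (\<lambda>s. of_real s ^ k * exp (- (z * of_real s)))"
proof -
  have "(\<lambda>s. complex_of_real s powr (of_nat (Suc k) - 1) / of_real (exp (Re z * s)))
      absolutely_integrable_on {0<..}"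
    using z by (intro absolutely_integrable_Gamma_integral) auto
  then have "integrable lebesgue (\<lambda>s. indicator {0<..} s
      *\<^sub>R (complex_of_real s powr (of_nat (Suc k) - 1) / of_real (exp (Re z * s))))"
    by (simp add: set_integrable_def)
  also have "(\<lambda>s. indicator {0<..} s *\<^sub>R (complex_of_real s powr (of_nat (Suc k) - 1) / of_real (exp (Re z * s))))
      = (\<lambda>s. indicator {0<..} s *\<^sub>R (complex_of_real s ^ k * of_real (exp (- (Re z * s)))))"
    by (auto simp: fun_eq_iff indicator_def powr_nat' exp_minus divide_inverse)
  finally have "integrable lborel (\<lambda>s. indicator {0<..} s *\<^sub>R (complex_of_real s ^ k * of_real (exp (- (Re z * s)))))"
    by (subst (asm) integrable_completion) auto
  then show ?thesis
    unfolding set_integrable_def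
    by (rule Bochner_Integration.integrable_bound)
       (auto simp: norm_mult norm_power indicator_def)
qed

lemma set_integral_power_exp:
  fixes z :: complex
  assumes z: "0 < Re z"
  shows "(LINT s:{0<..}|lborel. of_real s ^ k * exp (- (z * of_real s))) = fact k / z ^ (k + 1)"
proof (induction k)
  \<comment> \<open>The derivative of \<open>s\<^sup>k exp (-z s)\<close> integrates to a boundary term; this is the recursion in \<open>k\<close>.\<close>
  have z0: "z \<noteq> 0" using z by auto
  have FTC: "(LINT s:{0<..}|lborel. of_nat k * of_real s ^ (k - 1) * exp (- (z * of_real s))
        - z * (of_real s ^ k * exp (- (z * of_real s)))) = - (if k = 0 then 1 else 0)" for k
  proof -
    let ?F = "\<lambda>s. complex_of_real s ^ k * exp (- (z * of_real s))"
    let ?f = "\<lambda>s. of_nat k * complex_of_real s ^ (k - 1) * exp (- (z * of_real s))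
        - z * (of_real s ^ k * exp (- (z * of_real s)))"
    have "(?F has_vector_derivative ?f s) (at s)" for s
    proof -
      have "((\<lambda>w. w ^ k * exp (- (z * w))) has_field_derivative ?f s) (at (of_real s))"
        by (auto intro!: derivative_eq_intros simp: algebra_simps)
      from has_vector_derivative_real_field[OF this] show ?thesis .
    qed
    moreover have "isCont ?f s" for s
      by (intro continuous_intros)
    moreover have "set_integrable lborel (einterval 0 \<infinity>) ?f"
    proof -
      have "set_integrable lborel {0<..} (\<lambda>s. of_nat k * (complex_of_real s ^ (k - 1) * exp (- (z * of_real s)))
        - z * (of_real s ^ k * exp (- (z * of_real s))))"
        by (intro set_integral_diff set_integrable_mult_right set_integrable_power_exp z)
      then show ?thesis by (simp add: zero_ereal_def mult.assoc)
    qed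
    \<comment> \<open>The boundary value at 0 is 0^k, nonzero only for k = 0, and this starts the
      recursion.\<close>
    moreover have "((?F \<circ> real_of_ereal) \<longlongrightarrow> (if k = 0 then 1 else 0)) (at_right 0)"
    proof -
      have "isCont ?F 0" by (intro continuous_intros)
      then have "(?F \<longlongrightarrow> ?F 0) (at_right 0)"
        by (simp add: isCont_def filterlim_at_split)
      then show ?thesis
        unfolding zero_ereal_def ereal_tendsto_simps1 by (simp add: power_0_left)
    qed
    moreover have "((?F \<circ> real_of_ereal) \<longlongrightarrow> 0) (at_left \<infinity>)"
    proof -
      have "filterlim (\<lambda>s. Re z * s) at_top at_top"
        using z by (intro filterlim_tendsto_pos_mult_at_top[OF tendsto_const] filterlim_ident) auto
      from filterlim_compose[OF tendsto_power_div_exp_0 this]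
      have "((\<lambda>s. (Re z * s) ^ k / exp (Re z * s) / Re z ^ k) \<longlongrightarrow> 0 / Re z ^ k) at_top"
        using z by (intro tendsto_divide tendsto_const) auto
      also have "(\<lambda>s. (Re z * s) ^ k / exp (Re z * s) / Re z ^ k) = (\<lambda>s. s ^ k * exp (- (Re z * s)))"
        using z by (simp add: fun_eq_iff power_mult_distrib exp_minus field_simps)
      finally have "((\<lambda>s. s ^ k * exp (- (Re z * s))) \<longlongrightarrow> 0) at_top" by simp
      from tendsto_norm[OF this] have "((\<lambda>s. norm (?F s)) \<longlongrightarrow> 0) at_top"
        by (simp add: norm_mult norm_power abs_mult power_abs)
      then have "(?F \<longlongrightarrow> 0) at_top" by (rule tendsto_norm_zero_cancel)
      then show ?thesis unfolding ereal_tendsto_simps1 .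
    qed
    ultimately have "(LBINT s=0..\<infinity>. ?f s) = 0 - (if k = 0 then 1 else 0)"
      by (intro interval_integral_FTC_integrable[where F = ?F]) auto
    then show ?thesis by (simp add: interval_integral_to_infinity_eq zero_ereal_def)
  qed
  have int: "set_integrable lborel {0<..} (\<lambda>s. of_real s ^ k * exp (- (z * of_real s)))" for k
    by (rule set_integrable_power_exp[OF z])
  {
    case 0
    have "(LINT s:{0<..}|lborel. - z * (of_real s ^ 0 * exp (- (z * of_real s)))) = - 1"
      using FTC[of 0] by simp
    then show ?case using z0 by (subst (asm) set_integral_mult_right) (simp add: field_simps)
  next
    case (Suc k)
    have "of_nat (Suc k) * (LINT s:{0<..}|lborel. of_real s ^ k * exp (- (z * of_real s)))
        - z * (LINT s:{0<..}|lborel. of_real s ^ Suc k * exp (- (z * of_real s))) = 0"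
      using FTC[of "Suc k"]
      by (subst set_integral_mult_right[symmetric])+
         (subst set_integral_diff(2)[symmetric], auto intro!: int simp: mult.assoc simp del: of_nat_Suc power_Suc)
    then show ?case using z0 Suc.IH by (simp add: field_simps)
  }
qed

lemma AE_radial_measure: "AE s in radial_measure d. 0 < s"
  unfolding radial_measure_def by (subst AE_density) (auto simp: indicator_def)

text \<open>Bochner integration against a density expects one real-valued function under
  \<open>ennreal\<close>, not a product in \<open>ennreal\<close>.\<close>

lemma radial_measure_eq:
  "radial_measure d = density lborel (\<lambda>s. ennreal (indicator {0<..} s * s ^ (d - 1)))"
  unfolding radial_measure_def by (intro arg_cong2[where f = density] refl) (auto simp: fun_eq_iff indicator_def)

lemma
  fixes z :: complex
  assumes z: "0 < Re z"
  shows integrable_radial_power_exp: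
      "integrable (radial_measure d) (\<lambda>s. of_real s ^ k * exp (- (z * of_real s)))"
    and integral_radial_power_exp:
      "(LINT s|radial_measure d. of_real s ^ k * exp (- (z * of_real s)))
        = fact (d - 1 + k) / z ^ (d - 1 + k + 1)"
proof -
  have eq: "(indicator {0<..} s * s ^ (d - 1)) *\<^sub>R (complex_of_real s ^ k * exp (- (z * of_real s)))
      = indicator {0<..} s *\<^sub>R (of_real s ^ (d - 1 + k) * exp (- (z * of_real s)))" for s
    by (simp add: power_add scaleR_conv_of_real)
  have nn: "AE s in lborel. 0 \<le> indicator {0<..} s * (s::real) ^ (d - 1)"
    by (auto simp: indicator_def)
  show "integrable (radial_measure d) (\<lambda>s. of_real s ^ k * exp (- (z * of_real s)))"
    unfolding radial_measure_eq using set_integrable_power_exp[OF z, of "d - 1 + k"]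
    by (subst integrable_density[OF _ _ nn]) (auto simp only: eq set_integrable_def intro!: borel_measurable_continuous_onI continuous_intros, auto)
  show "(LINT s|radial_measure d. of_real s ^ k * exp (- (z * of_real s)))
        = fact (d - 1 + k) / z ^ (d - 1 + k + 1)"
    unfolding radial_measure_eq set_integral_power_exp[OF z, symmetric]
    by (subst integral_density[OF _ _ nn]) (auto simp only: eq set_lebesgue_integral_def intro!: borel_measurable_continuous_onI continuous_intros, auto)
qed

section \<open>Integrability on the sphere and in polar coordinates\<close>

lemma borel_measurable_sphere_measure:
  assumes "continuous_on (sphere 0 1) h"
  shows "h \<in> borel_measurable sphere_measure"
  using borel_measurable_continuous_on_restrict[OF assms]
  by (simp add: measurable_cong_sets[OF sets_sphere_measure refl])

lemma integrable_sphere_measure: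
  fixes h :: "'a::euclidean_space \<Rightarrow> 'b::{banach, second_countable_topology}"
  assumes h: "continuous_on (sphere 0 1) h"
  shows "integrable sphere_measure h"
proof -
  interpret finite_measure "sphere_measure :: 'a measure" by (rule finite_measure_sphere_measure)
  have "bounded (h ` sphere 0 1)" by (intro compact_imp_bounded compact_continuous_image h) simp
  then obtain M where "\<forall>y\<in>h ` sphere 0 1. norm y \<le> M" unfolding bounded_iff by blast
  then show ?thesis
    by (intro integrable_const_bound[of _ M] borel_measurable_sphere_measure h)
       (auto simp: space_sphere_measure intro!: AE_I2)
qed

text \<open>The majorant depends on the radius alone, and the sphere has finite measure, so it is
  integrable over the product.\<close>

lemma integrable_polar_bound:
  fixes f :: "'a::euclidean_space \<Rightarrow> complex"
  assumes f [measurable]: "f \<in> borel_measurable borel" and c: "0 < c"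
    and bound: "\<And>x. norm (f x) \<le> (\<Sum>i\<in>I. K i * norm x ^ k i * exp (- c * norm x))"
  shows "integrable (sphere_measure \<Otimes>\<^sub>M radial_measure d) (\<lambda>(\<sigma>, s). f (s *\<^sub>R \<sigma>))"
proof -
  interpret R: sigma_finite_measure "radial_measure d" by (rule sigma_finite_radial_measure)
  interpret S: finite_measure "sphere_measure :: 'a measure" by (rule finite_measure_sphere_measure)
  interpret P: pair_sigma_finite "sphere_measure :: 'a measure" "radial_measure d" ..
  \<comment> \<open>Absolute values make the bound hold for every real s, as the space of
    \<open>radial_measure\<close> is the whole line.\<close>
  let ?H = "\<lambda>s::real. \<Sum>i\<in>I. K i * \<bar>s\<bar> ^ k i * exp (- c * \<bar>s\<bar>)"
  have H: "integrable (radial_measure d) ?H"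
  proof (intro Bochner_Integration.integrable_sum)
    fix i
    have "integrable (radial_measure d) (\<lambda>s. K i * norm (complex_of_real s ^ k i * exp (- (complex_of_real c * of_real s))))"
      using c by (intro integrable_mult_right integrable_norm integrable_radial_power_exp) simp
    then show "integrable (radial_measure d) (\<lambda>s. K i * \<bar>s\<bar> ^ k i * exp (- c * \<bar>s\<bar>))"
      by (rule integrable_cong_AE_imp)
         (auto intro!: eventually_mono[OF AE_radial_measure] simp: norm_mult norm_power)
  qed
  have "integrable (sphere_measure \<Otimes>\<^sub>M radial_measure d) (\<lambda>p::'a \<times> real. ?H (snd p))"
    using H by (intro P.Fubini_integrable) (auto intro: S.integrable_const)
  then show ?thesis
  proof (rule Bochner_Integration.integrable_bound)
    show "(\<lambda>(\<sigma>, s). f (s *\<^sub>R \<sigma>)) \<in> borel_measurable (sphere_measure \<Otimes>\<^sub>M radial_measure d)"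
      using measurable_compose[OF measurable_polar f] by (simp add: case_prod_unfold)
    have "norm (f (s *\<^sub>R \<sigma>)) \<le> norm (?H s)" if "\<sigma> \<in> sphere 0 1" for \<sigma> :: 'a and s
      using bound[of "s *\<^sub>R \<sigma>"] that by (auto intro: order_trans[OF _ abs_ge_self])
    then show "AE p in sphere_measure \<Otimes>\<^sub>M radial_measure d.
        norm (case p of (\<sigma>, s) \<Rightarrow> f (s *\<^sub>R \<sigma>)) \<le> norm (?H (snd p))"
      by (intro AE_I2) (auto simp: space_pair_measure space_sphere_measure)
  qed
qed

section \<open>The kernel in polar coordinates\<close>

context
  fixes B :: "real^'m \<Rightarrow> real^'m \<Rightarrow> real^'r" and n :: nat and \<mu> v
  assumes card: "CARD('m) = 2 * n" and frame: "admissible_frame n B \<mu> v"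
begin

lemma half_dim_pos: "1 \<le> n"
  using card zero_less_card_finite[where 'a = 'm] by linarith

text \<open>Only the Laguerre factors depend on k, so \<open>laguerre_sum_formula\<close> applies.
  This eliminates the frame, whose choice may be irregular in \<tau>, in favour of
  \<open>Babs\<close>, which is continuous on the sphere.\<close>

lemma Q_eq:
  assumes "\<tau> \<noteq> 0"
  shows "Q n \<mu> v m y \<tau> = (2 / pi) ^ n * sqrt (det (Babs B \<tau>))
    * laguerre (real n - 1) m (2 * ((Babs B \<tau> *v y) \<bullet> y)) * exp (- ((Babs B \<tau> *v y) \<bullet> y))"
proof -
  let ?p = "pair_normsq (v \<tau>) y"
  note facts = Babs_facts[OF card frame assms]
  have "Q n \<mu> v m y \<tau> = (\<Prod>j=1..n. 2 / pi * \<mu> \<tau> j)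
      * (\<Sum>k | k \<in> {1..n} \<rightarrow>\<^sub>E (UNIV :: nat set) \<and> (\<Sum>j=1..n. k j) = m.
          \<Prod>j=1..n. laguerre 0 (k j) (2 * \<mu> \<tau> j * ?p j))
      * (\<Prod>j=1..n. exp (- \<mu> \<tau> j * ?p j))"
    unfolding Q_def scriptL_def sum_distrib_left sum_distrib_right
    by (intro sum.cong refl, unfold prod.distrib[symmetric], intro prod.cong refl) simp
  also have "\<dots> = (2 / pi) ^ n * (\<Prod>j=1..n. \<mu> \<tau> j)
      * laguerre (real n - 1) m (2 * (\<Sum>j=1..n. \<mu> \<tau> j * ?p j)) * exp (- (\<Sum>j=1..n. \<mu> \<tau> j * ?p j))"
  proof -
    have "(\<Prod>j=1..n. 2 / pi * \<mu> \<tau> j) = (2 / pi) ^ n * (\<Prod>j=1..n. \<mu> \<tau> j)"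
      unfolding prod.distrib by simp
    moreover have "(\<Prod>j=1..n. exp (- \<mu> \<tau> j * ?p j)) = exp (- (\<Sum>j=1..n. \<mu> \<tau> j * ?p j))"
      by (simp add: exp_sum sum_negf[symmetric] del: sum_negf)
    ultimately show ?thesis
      by (simp only: laguerre_sum_formula[OF half_dim_pos] sum_distrib_left mult.assoc)
  qed
  finally show ?thesis by (simp add: facts)
qed

lemma quad_Babs_scaleR:
  assumes "0 < c" "\<tau> \<noteq> 0"
  shows "(Babs B (c *\<^sub>R \<tau>) *v y) \<bullet> y = c * ((Babs B \<tau> *v y) \<bullet> y)"
  using Babs_scaleR[OF card frame assms] by (simp flip: scaleR_matrix_vector_assoc)

text \<open>The determinant has degree 2n in the matrix, hence its root has degree n.\<close>

lemma sqrt_det_Babs_scaleR: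
  assumes "0 < c" "\<tau> \<noteq> 0"
  shows "sqrt (det (Babs B (c *\<^sub>R \<tau>))) = c ^ n * sqrt (det (Babs B \<tau>))"
proof -
  have "sqrt (c ^ (2 * n)) = c ^ n"
    using assms by (simp add: power_even_eq)
  then show ?thesis
    using Babs_scaleR[OF card frame assms] by (simp add: det_scaleR card real_sqrt_mult)
qed

lemma continuous_on_quad_Babs: "continuous_on (sphere 0 1) (\<lambda>\<sigma>. (Babs B \<sigma> *v y) \<bullet> y)"
  by (intro continuous_on_inner continuous_on_matrix_vector continuous_on_Babs[OF card frame] continuous_on_const)

lemma continuous_on_sqrt_det_Babs: "continuous_on (sphere 0 1) (\<lambda>\<sigma>. sqrt (det (Babs B \<sigma>)))"
  by (intro continuous_on_real_sqrt continuous_on_det continuous_on_Babs[OF card frame])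

text \<open>Compactness of the sphere turns pointwise positivity into a uniform decay rate c and
  bounds the coefficients by M; both enter the majorant of the density.\<close>

lemma quad_Babs_bounds:
  assumes "y \<noteq> 0"
  obtains c M where "0 < c" "0 \<le> M"
    "\<And>\<sigma>. norm \<sigma> = 1 \<Longrightarrow> c \<le> (Babs B \<sigma> *v y) \<bullet> y"
    "\<And>\<sigma>. norm \<sigma> = 1 \<Longrightarrow> (Babs B \<sigma> *v y) \<bullet> y \<le> M"
    "\<And>\<sigma>. norm \<sigma> = 1 \<Longrightarrow> \<bar>sqrt (det (Babs B \<sigma>))\<bar> \<le> M"
proof -
  let ?S = "sphere 0 1 :: (real^'r) set"
  have S: "compact ?S" "?S \<noteq> {}" by auto
  obtain \<sigma>0 where \<sigma>0: "\<sigma>0 \<in> ?S" "\<And>\<sigma>. \<sigma> \<in> ?S \<Longrightarrow> (Babs B \<sigma>0 *v y) \<bullet> y \<le> (Babs B \<sigma> *v y) \<bullet> y"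
    using continuous_attains_inf[OF S continuous_on_quad_Babs[of y]] by blast
  have "\<sigma>0 \<noteq> 0" using \<sigma>0(1) by auto
  then have c: "0 < (Babs B \<sigma>0 *v y) \<bullet> y" using Babs_facts(5)[OF card frame _ assms] by simp
  obtain \<sigma>1 where \<sigma>1: "\<And>\<sigma>. \<sigma> \<in> ?S \<Longrightarrow> (Babs B \<sigma> *v y) \<bullet> y \<le> (Babs B \<sigma>1 *v y) \<bullet> y"
    using continuous_attains_sup[OF S continuous_on_quad_Babs[of y]] by blast
  obtain \<sigma>2 where \<sigma>2: "\<And>\<sigma>. \<sigma> \<in> ?S \<Longrightarrow> \<bar>sqrt (det (Babs B \<sigma>))\<bar> \<le> \<bar>sqrt (det (Babs B \<sigma>2))\<bar>"
    using continuous_attains_sup[OF S continuous_on_rabs[OF continuous_on_sqrt_det_Babs]] by blast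
  show ?thesis
    using that[of "(Babs B \<sigma>0 *v y) \<bullet> y" "max \<bar>(Babs B \<sigma>1 *v y) \<bullet> y\<bar> \<bar>sqrt (det (Babs B \<sigma>2))\<bar>"]
      c \<sigma>0(2) \<sigma>1 \<sigma>2 by (simp add: le_max_iff_disj) (meson abs_ge_self order_trans)
qed

text \<open>The integrand of \<open>P\<close>, set to 0 at the origin, where the frame is unconstrained.\<close>

definition Pdensity :: "nat \<Rightarrow> real^'m \<Rightarrow> real^'r \<Rightarrow> real^'r \<Rightarrow> complex" where
  "Pdensity m y t \<tau> = indicator (- {0}) \<tau> * exp (\<i> * of_real (t \<bullet> \<tau>)) * of_real (Q n \<mu> v m y \<tau>)"

text \<open>By homogeneity the root of the determinant gives s^n and the i-th Laguerre term s^i,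
  while the phase and the Gaussian factor merge into one complex exponential: each term is ready for
  a Laplace transform in s.\<close>

lemma Pdensity_polar:
  fixes y :: "real^'m"
  assumes s: "0 < s" and \<sigma>: "norm \<sigma> = 1"
  defines "b \<equiv> (Babs B \<sigma> *v y) \<bullet> y"
  shows "Pdensity m y t (s *\<^sub>R \<sigma>) = (\<Sum>i\<le>m. of_real ((2 / pi) ^ n * sqrt (det (Babs B \<sigma>))
      * (-1) ^ i * real ((m + n - 1) choose (m - i)) * (2 * b) ^ i / fact i)
      * (of_real s ^ (n + i) * exp (- ((of_real b - \<i> * of_real (t \<bullet> \<sigma>)) * of_real s))))"
proof -
  have "\<sigma> \<noteq> 0" using \<sigma> by auto
  have e: "exp (\<i> * of_real (t \<bullet> (s *\<^sub>R \<sigma>))) * of_real (exp (- (s * b)))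
      = exp (- ((of_real b - \<i> * of_real (t \<bullet> \<sigma>)) * of_real s))"
    by (simp add: exp_of_real[symmetric] mult_exp_exp algebra_simps)
  have "of_real (Q n \<mu> v m y (s *\<^sub>R \<sigma>)) = (\<Sum>i\<le>m. of_real ((2 / pi) ^ n * sqrt (det (Babs B \<sigma>))
      * (-1) ^ i * real ((m + n - 1) choose (m - i)) * (2 * b) ^ i / fact i)
      * of_real s ^ (n + i)) * complex_of_real (exp (- (s * b)))"
    using s \<open>\<sigma> \<noteq> 0\<close>
    by (simp add: Q_eq quad_Babs_scaleR sqrt_det_Babs_scaleR laguerre_nat[OF half_dim_pos] b_def[symmetric]
        sum_distrib_left sum_distrib_right power_add power_mult_distrib mult_ac)
  then have "Pdensity m y t (s *\<^sub>R \<sigma>) = (\<Sum>i\<le>m. of_real ((2 / pi) ^ n * sqrt (det (Babs B \<sigma>))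
      * (-1) ^ i * real ((m + n - 1) choose (m - i)) * (2 * b) ^ i / fact i)
      * of_real s ^ (n + i)) * (exp (\<i> * of_real (t \<bullet> (s *\<^sub>R \<sigma>))) * of_real (exp (- (s * b))))"
    using s \<open>\<sigma> \<noteq> 0\<close> by (simp add: Pdensity_def mult_ac)
  then show ?thesis unfolding e by (simp add: sum_distrib_right mult.assoc)
qed

text \<open>This form serves measurability. Each function of the direction is continuous away from 0
  only; multiplied by the indicator it becomes Borel on the whole space.\<close>

lemma Pdensity_eq:
  fixes y :: "real^'m"
  defines "b \<equiv> \<lambda>\<tau>. (Babs B (\<tau> /\<^sub>R norm \<tau>) *v y) \<bullet> y"
    and "D \<equiv> \<lambda>\<tau>. sqrt (det (Babs B (\<tau> /\<^sub>R norm \<tau>)))"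
  shows "Pdensity m y t \<tau> = (\<Sum>i\<le>m. of_real ((2 / pi) ^ n * (indicator (- {0}) \<tau> *\<^sub>R D \<tau>)
      * (-1) ^ i * real ((m + n - 1) choose (m - i)) * (2 * (indicator (- {0}) \<tau> *\<^sub>R b \<tau>)) ^ i / fact i)
      * (of_real (norm \<tau>) ^ (n + i) * exp (\<i> * of_real (t \<bullet> \<tau>) - of_real (norm \<tau> * (indicator (- {0}) \<tau> *\<^sub>R b \<tau>)))))"
proof (cases "\<tau> = 0")
  case True
  then show ?thesis using half_dim_pos by (simp add: Pdensity_def)
next
  case False
  let ?\<sigma> = "\<tau> /\<^sub>R norm \<tau>"
  have \<tau>: "0 < norm \<tau>" "norm ?\<sigma> = 1" "Pdensity m y t \<tau> = Pdensity m y t (norm \<tau> *\<^sub>R ?\<sigma>)"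
    using False by simp_all
  have e: "- ((complex_of_real ((Babs B ?\<sigma> *v y) \<bullet> y) - \<i> * of_real (t \<bullet> ?\<sigma>)) * of_real (norm \<tau>))
      = \<i> * of_real (t \<bullet> \<tau>) - of_real (norm \<tau> * ((Babs B ?\<sigma> *v y) \<bullet> y))"
    using False by (simp add: field_simps)
  show ?thesis
    unfolding \<tau>(3) Pdensity_polar[OF \<tau>(1,2)] e using False by (simp add: b_def D_def)
qed

lemma borel_measurable_Pdensity [measurable]: "Pdensity m y t \<in> borel_measurable borel"
proof -
  have *: "continuous_on (- {0}) (\<lambda>\<tau>::real^'r. \<tau> /\<^sub>R norm \<tau>)"
    by (intro continuous_intros) auto
  have **: "(\<lambda>\<tau>::real^'r. \<tau> /\<^sub>R norm \<tau>) ` (- {0}) \<subseteq> sphere 0 1"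
    by (simp add: image_subset_iff)
  note [measurable] =
    borel_measurable_continuous_on_indicator[OF _ continuous_on_compose2[OF continuous_on_quad_Babs * **]]
    borel_measurable_continuous_on_indicator[OF _ continuous_on_compose2[OF continuous_on_sqrt_det_Babs * **]]
  show ?thesis unfolding Pdensity_eq[abs_def] by measurable
qed

lemma integrable_Pdensity_polar:
  assumes "y \<noteq> 0"
  shows "integrable (sphere_measure \<Otimes>\<^sub>M radial_measure d) (\<lambda>(\<sigma>, s). Pdensity m y t (s *\<^sub>R \<sigma>))"
proof -
  obtain c M where c: "0 < c" and M: "0 \<le> M"
    and cb: "\<And>\<sigma>. norm \<sigma> = 1 \<Longrightarrow> c \<le> (Babs B \<sigma> *v y) \<bullet> y"
    and bM: "\<And>\<sigma>. norm \<sigma> = 1 \<Longrightarrow> (Babs B \<sigma> *v y) \<bullet> y \<le> M"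
    and DM: "\<And>\<sigma>. norm \<sigma> = 1 \<Longrightarrow> \<bar>sqrt (det (Babs B \<sigma>))\<bar> \<le> M"
    using quad_Babs_bounds[OF assms] by metis
  \<comment> \<open>K i bounds the i-th coefficient in \<open>Pdensity_polar\<close> uniformly over
    directions.\<close>
  define K where "K i = (2 / pi) ^ n * M * real ((m + n - 1) choose (m - i)) * (2 * M) ^ i / fact i" for i
  have K: "0 \<le> K i" for i using M by (simp add: K_def)
  show ?thesis
  proof (rule integrable_polar_bound[OF borel_measurable_Pdensity c])
    fix \<tau> :: "real^'r"
    show "norm (Pdensity m y t \<tau>) \<le> (\<Sum>i\<le>m. K i * norm \<tau> ^ (n + i) * exp (- c * norm \<tau>))"
    proof (cases "\<tau> = 0")
      case True
      then show ?thesis using K by (simp add: Pdensity_def sum_nonneg)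
    next
      case False
      let ?\<sigma> = "\<tau> /\<^sub>R norm \<tau>"
      let ?b = "(Babs B ?\<sigma> *v y) \<bullet> y"
      have \<sigma>: "norm ?\<sigma> = 1" and \<tau>: "0 < norm \<tau>" using False by simp_all
      note b = cb[OF \<sigma>] bM[OF \<sigma>] DM[OF \<sigma>]
      have "norm (Pdensity m y t \<tau>) = norm (Pdensity m y t (norm \<tau> *\<^sub>R ?\<sigma>))" using False by simp
      also have "\<dots> \<le> (\<Sum>i\<le>m. K i * norm \<tau> ^ (n + i) * exp (- c * norm \<tau>))"
        unfolding Pdensity_polar[OF \<tau> \<sigma>]
      proof (rule sum_norm_le)
        fix i
        let ?X = "(2 / pi) ^ n * sqrt (det (Babs B ?\<sigma>)) * (-1) ^ i
          * real ((m + n - 1) choose (m - i)) * (2 * ?b) ^ i / fact i"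
        let ?E = "exp (- ((complex_of_real ?b - \<i> * of_real (t \<bullet> ?\<sigma>)) * of_real (norm \<tau>)))"
        have b0: "0 \<le> ?b" using b c by linarith
        have "\<bar>?X\<bar> = (2 / pi) ^ n * real ((m + n - 1) choose (m - i)) / fact i
            * (\<bar>sqrt (det (Babs B ?\<sigma>))\<bar> * (2 * ?b) ^ i)"
          using b0 by (simp add: abs_mult power_abs mult_ac)
        also have "\<dots> \<le> (2 / pi) ^ n * real ((m + n - 1) choose (m - i)) / fact i * (M * (2 * M) ^ i)"
          using b b0 M by (intro mult_left_mono mult_mono power_mono) auto
        also have "\<dots> = K i" by (simp add: K_def)
        finally have X: "\<bar>?X\<bar> \<le> K i" .
        have E: "norm ?E \<le> exp (- c * norm \<tau>)"
          using b(1) by (simp add: mult_right_mono)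
        have "norm (complex_of_real ?X * (of_real (norm \<tau>) ^ (n + i) * ?E))
            = \<bar>?X\<bar> * (norm \<tau> ^ (n + i) * norm ?E)"
          by (simp only: norm_mult norm_of_real norm_power abs_norm_cancel)
        also have "\<dots> \<le> K i * (norm \<tau> ^ (n + i) * exp (- c * norm \<tau>))"
          by (intro mult_mono X mult_left_mono E K) auto
        finally show "norm (complex_of_real ?X * (of_real (norm \<tau>) ^ (n + i) * ?E))
            \<le> K i * norm \<tau> ^ (n + i) * exp (- c * norm \<tau>)"
          by (simp only: mult.assoc)
      qed
      finally show ?thesis .
    qed
  qed
qed

end

section \<open>Radial integration and the final formula\<close>

text \<open>From z + w = 2b one gets (2b)^i / z^i = (1 + w/z)^i, so
  \<open>laguerre_laplace_identity\<close> applies once 1 / z^(n+r) is taken out. The factor (2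
  pi)^r anticipates the normalisation of \<open>P\<close>.\<close>

lemma laguerre_laplace_polar:
  fixes z w :: complex and b :: real
  assumes z: "z \<noteq> 0" and zw: "z + w = 2 * of_real b" and n: "1 \<le> n" and r: "1 \<le> r"
  shows "(\<Sum>i\<le>m. of_real ((2 / pi) ^ n * D * (-1) ^ i * real ((m + n - 1) choose (m - i)) * (2 * b) ^ i / fact i)
      * (fact (r - 1 + (n + i)) / z ^ (r - 1 + (n + i) + 1)))
    = (2 * of_real pi) ^ r * (\<Sum>j=0..r. of_real (C_const n r m j)
      * (of_real D * w powi (int m - int j) / z powi (int m + int n + int r - int j)))"
proof -
  let ?w = "w / z"
  have w1: "1 + ?w = of_real (2 * b) / z" using z zw by (simp add: field_simps)
  have exp1: "r - 1 + (n + i) = n + r - 1 + i" "n + r - 1 + i + 1 = n + r + i" for i using r by auto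
  have "(\<Sum>i\<le>m. of_real ((2 / pi) ^ n * D * (-1) ^ i * real ((m + n - 1) choose (m - i)) * (2 * b) ^ i / fact i)
      * (fact (r - 1 + (n + i)) / z ^ (r - 1 + (n + i) + 1)))
    = of_real ((2 / pi) ^ n * D) / z ^ (n + r)
      * (\<Sum>i\<le>m. (-1) ^ i * of_nat ((m + n - 1) choose (m - i)) * (fact (n + r - 1 + i) / fact i) * (1 + ?w) ^ i)"
    unfolding sum_distrib_left w1 exp1
    by (intro sum.cong refl) (simp add: power_divide power_add mult_ac)
  also have "\<dots> = of_real ((2 / pi) ^ n * D) / z ^ (n + r) * ((-1) ^ m * (\<Sum>j=0..r. if j \<le> m
      then of_nat (r choose j) * (fact (m + n + r - 1 - j) / fact (m - j)) * ?w ^ (m - j) else 0))"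
    by (subst laguerre_laplace_identity[OF n]) simp
  also have "\<dots> = (2 * of_real pi) ^ r * (\<Sum>j=0..r. of_real (C_const n r m j)
      * (of_real D * w powi (int m - int j) / z powi (int m + int n + int r - int j)))"
    unfolding sum_distrib_left
  proof (intro sum.cong refl)
    fix j
    show "of_real ((2 / pi) ^ n * D) / z ^ (n + r) * ((-1) ^ m * (if j \<le> m
        then of_nat (r choose j) * (fact (m + n + r - 1 - j) / fact (m - j)) * ?w ^ (m - j) else 0))
      = (2 * of_real pi) ^ r * (of_real (C_const n r m j)
      * (of_real D * w powi (int m - int j) / z powi (int m + int n + int r - int j)))"
    \<comment> \<open>For j > m both sides vanish through the convention in \<open>C_const\<close>,
      whatever the value of the negative power of w; otherwise both integer powers are natural
      ones.\<close>
    proof (cases "j \<le> m")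
      case True
      have pw: "w powi (int m - int j) = w ^ (m - j)"
        "z powi (int m + int n + int r - int j) = z ^ (n + r) * z ^ (m - j)"
      proof -
        have "int m - int j = int (m - j)" "int m + int n + int r - int j = int (n + r + (m - j))"
          using True by auto
        then show "w powi (int m - int j) = w ^ (m - j)"
          "z powi (int m + int n + int r - int j) = z ^ (n + r) * z ^ (m - j)"
          by (simp_all only: power_int_of_nat power_add)
      qed
      have "(2 * pi) ^ r * (2 powi (int n - int r) / pi ^ (n + r)) = (2 / pi) ^ n"
        by (simp add: power_int_diff power_add power_mult_distrib power_divide)
      then have C: "(2 * pi) ^ r * C_const n r m j
          = (2 / pi) ^ n * (-1) ^ m * (real (r choose j) * (fact (m + n + r - 1 - j) / fact (m - j)))"
        using True by (simp add: C_const_def field_simps)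
      have "(2 * complex_of_real pi) ^ r * (of_real (C_const n r m j)
          * (of_real D * w powi (int m - int j) / z powi (int m + int n + int r - int j)))
        = of_real ((2 * pi) ^ r * C_const n r m j) * of_real D * w ^ (m - j) / (z ^ (n + r) * z ^ (m - j))"
        unfolding pw by simp
      then show ?thesis unfolding C using True
        by (simp add: power_divide mult_ac)
    qed (simp add: C_const_def)
  qed
  finally show ?thesis .
qed

theorem proposition1p1:
  fixes B :: "real^'m \<Rightarrow> real^'m \<Rightarrow> real^'r"
    and n m :: nat
    and \<mu> :: "real^'r \<Rightarrow> nat \<Rightarrow> real"
    and v :: "real^'r \<Rightarrow> nat \<Rightarrow> real^'m"
    and y :: "real^'m" and t :: "real^'r"
  assumes "CARD('m) = 2 * n"
    and "skew_bilinear B"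
    and "nondegenerate B"
    and "admissible_frame n B \<mu> v"
    and "y \<noteq> 0"
  shows "P n \<mu> v m y t =
    (\<Sum>j=0..CARD('r). of_real (C_const n CARD('r) m j) * I_int n B m j y t)"
proof -
  note ctx = assms(1,4)
  let ?r = "CARD('r)"
  let ?g = "Pdensity n \<mu> v m y t"
  define b where "b \<sigma> = (Babs B \<sigma> *v y) \<bullet> y" for \<sigma>
  define D where "D \<sigma> = sqrt (det (Babs B \<sigma>))" for \<sigma>
  define w where "w \<sigma> = complex_of_real (b \<sigma>) + \<i> * of_real (t \<bullet> \<sigma>)" for \<sigma>
  define z where "z \<sigma> = complex_of_real (b \<sigma>) - \<i> * of_real (t \<bullet> \<sigma>)" for \<sigma>
  define h where "h j \<sigma> = of_real (D \<sigma>) * w \<sigma> powi (int m - int j) / z \<sigma> powi (int m + int n + int ?r - int j)" for j \<sigma>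
  have r: "1 \<le> ?r" by (simp add: Suc_leI)
  \<comment> \<open>Positivity of b puts z in the right half plane, where the Laplace transforms
    converge.\<close>
  have b: "0 < b \<sigma>" if "norm \<sigma> = 1" for \<sigma>
    using that Babs_facts(5)[OF ctx, of \<sigma> y] assms(5) by (force simp: b_def)
  \<comment> \<open>The two integrands differ at most at the origin.\<close>
  have "(LINT \<tau>|lborel. exp (\<i> * of_real (t \<bullet> \<tau>)) * of_real (Q n \<mu> v m y \<tau>)) = integral\<^sup>L lborel ?g"
    by (rule integral_discrete_difference[of "{0}"]) (auto simp: Pdensity_def[OF ctx])
  also have "\<dots> = (LINT \<sigma>|sphere_measure. LINT s|radial_measure ?r. ?g (s *\<^sub>R \<sigma>))"
    using integral_polar[OF borel_measurable_Pdensity[OF ctx] integrable_Pdensity_polar[OF ctx assms(5)]] by simp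
  also have "\<dots> = (LINT \<sigma>|sphere_measure. (2 * of_real pi) ^ ?r * (\<Sum>j=0..?r. of_real (C_const n ?r m j) * h j \<sigma>))"
  proof (rule Bochner_Integration.integral_cong[OF refl])
    fix \<sigma> :: "real^'r" assume "\<sigma> \<in> space sphere_measure"
    then have \<sigma>: "norm \<sigma> = 1" by (simp add: space_sphere_measure)
    have z: "0 < Re (z \<sigma>)" using b[OF \<sigma>] by (simp add: z_def)
    let ?a = "\<lambda>i. complex_of_real ((2 / pi) ^ n * D \<sigma> * (-1) ^ i * real ((m + n - 1) choose (m - i)) * (2 * b \<sigma>) ^ i / fact i)"
    let ?e = "\<lambda>i s. complex_of_real s ^ (n + i) * exp (- (z \<sigma> * of_real s))"
    have [measurable]: "?g \<in> borel_measurable borel" by (rule borel_measurable_Pdensity[OF ctx])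
    \<comment> \<open>The expansion along the ray is known for s > 0 only, which is almost
      everywhere for \<open>radial_measure\<close>.\<close>
    have "(LINT s|radial_measure ?r. ?g (s *\<^sub>R \<sigma>)) = (LINT s|radial_measure ?r. (\<Sum>i\<le>m. ?a i * ?e i s))"
      by (rule integral_cong_AE)
         (auto intro!: eventually_mono[OF AE_radial_measure] borel_measurable_sum simp: Pdensity_polar[OF ctx _ \<sigma>] b_def D_def z_def)
    also have "\<dots> = (\<Sum>i\<le>m. ?a i * (LINT s|radial_measure ?r. ?e i s))"
      by (simp add: integrable_radial_power_exp[OF z])
    also have "\<dots> = (\<Sum>i\<le>m. ?a i * (fact (?r - 1 + (n + i)) / z \<sigma> ^ (?r - 1 + (n + i) + 1)))"
      by (simp only: integral_radial_power_exp[OF z])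
    also have "\<dots> = (2 * of_real pi) ^ ?r * (\<Sum>j=0..?r. of_real (C_const n ?r m j) * h j \<sigma>)"
      unfolding h_def using z
      by (intro laguerre_laplace_polar half_dim_pos[OF ctx] r) (auto simp: z_def w_def)
    finally show "(LINT s|radial_measure ?r. ?g (s *\<^sub>R \<sigma>))
        = (2 * of_real pi) ^ ?r * (\<Sum>j=0..?r. of_real (C_const n ?r m j) * h j \<sigma>)" .
  qed
  also have "\<dots> = (2 * of_real pi) ^ ?r * (\<Sum>j=0..?r. of_real (C_const n ?r m j) * (LINT \<sigma>|sphere_measure. h j \<sigma>))"
  proof -
    \<comment> \<open>Splitting the integral of the sum needs every term integrable: for j \<le> m
      the integrand is continuous on the sphere as w and z have no zeros there, and for j > m the
      coefficient is 0.\<close>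
    have "integrable sphere_measure (\<lambda>\<sigma>. of_real (C_const n ?r m j) * h j \<sigma>)" for j
    proof (cases "j \<le> m")
      case True
      have "continuous_on (sphere 0 1) b" "continuous_on (sphere 0 1) D"
        unfolding b_def D_def
        by (rule continuous_on_quad_Babs[OF ctx] continuous_on_sqrt_det_Babs[OF ctx])+
      then have "continuous_on (sphere 0 1) w" "continuous_on (sphere 0 1) z"
        "continuous_on (sphere 0 1) (\<lambda>\<sigma>. complex_of_real (D \<sigma>))"
        unfolding w_def z_def by (intro continuous_intros; simp)+
      moreover have "w \<sigma> \<noteq> 0" "z \<sigma> \<noteq> 0" if "norm \<sigma> = 1" for \<sigma>
        using b[OF that] by (auto simp: w_def z_def complex_eq_iff)
      ultimately have "continuous_on (sphere 0 1) (h j)"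
        unfolding h_def by (intro continuous_intros) auto
      then show ?thesis by (intro integrable_mult_right integrable_sphere_measure)
    qed (simp add: C_const_def)
    then show ?thesis by simp
  qed
  finally show ?thesis
    unfolding P_def I_int_def h_def b_def D_def w_def z_def by simp
qed

end
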